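(* Let $X$ be any uncountable sofic shift, and let $A^{\mathbb{Z}}$ be any full shift ($A$ a finite alphabet). Then $\mathrm{End}(A^{\mathbb{Z}}) \leq \mathrm{End}(X)$, i.e. there is an injective monoid homomorphism $\mathrm{End}(A^{\mathbb{Z}}) \to \mathrm{End}(X)$.
   Context: For a finite alphabet $S$, $S^{\mathbb{Z}}$ (the full shift) carries the product topology of discrete topologies, and the shift $\sigma : S^{\mathbb{Z}} \to S^{\mathbb{Z}}$ is $\sigma(x)_i = x_{i+1}$. A subshift is a closed set $X \subset S^{\mathbb{Z}}$ with $\sigma(X) = X$. A sofic shift is a subshift $X$ whose syntactic monoid is finite, where the syntactic monoid consists of the equivalence classes of words under $w \sim w'$ iff for all words $u,v$: $uwv$ occurs in some point of $X$ if and only if $uw'v$ occurs in some point of $X$ (equivalently, $X$ is the image of a subshift of finite type under a continuous shift-commuting map). A cellular automaton on a subshift $X$ is a continuous map $f : X \to X$ commuting with $\sigma$. $\mathrm{End}(X)$ is the monoid of all cellular automata on $X$ under composition, with identity element the identity map on $X$. Monoid homomorphisms preserve products and the identity element. *)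

theory Defs
  imports "HOL-Analysis.Analysis" "HOL-Algebra.Group"
begin

definition full_shift :: "'a set \<Rightarrow> (int \<Rightarrow> 'a) set" where
  "full_shift S = (UNIV \<rightarrow>\<^sub>E S)"

definition full_shift_topology :: "'a set \<Rightarrow> (int \<Rightarrow> 'a) topology" where
  "full_shift_topology S = product_topology (\<lambda>_. discrete_topology S) UNIV"

definition shift :: "(int \<Rightarrow> 'a) \<Rightarrow> int \<Rightarrow> 'a" where
  "shift x = (\<lambda>i. x (i + 1))"

definition subshift :: "'a set \<Rightarrow> (int \<Rightarrow> 'a) set \<Rightarrow> bool" where
  "subshift S X \<longleftrightarrow> closedin (full_shift_topology S) X \<and> shift ` X = X"

definition occurs_in :: "'a list \<Rightarrow> (int \<Rightarrow> 'a) \<Rightarrow> bool" where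
  "occurs_in w x \<longleftrightarrow> (\<exists>i. \<forall>k<length w. x (i + int k) = w ! k)"

definition language :: "(int \<Rightarrow> 'a) set \<Rightarrow> 'a list set" where
  "language X = {w. \<exists>x\<in>X. occurs_in w x}"

text \<open>Words range over all of \<open>lists S\<close>, not only over the language of \<open>X\<close>; the words
  that do not occur in \<open>X\<close> form a single class.\<close>

definition syntactic_rel :: "'a set \<Rightarrow> (int \<Rightarrow> 'a) set \<Rightarrow> ('a list \<times> 'a list) set" where
  "syntactic_rel S X = {(w, w'). w \<in> lists S \<and> w' \<in> lists S \<and>
     (\<forall>u\<in>lists S. \<forall>v\<in>lists S. u @ w @ v \<in> language X \<longleftrightarrow> u @ w' @ v \<in> language X)}"

definition syntactic_classes :: "'a set \<Rightarrow> (int \<Rightarrow> 'a) set \<Rightarrow> 'a list set set" where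
  "syntactic_classes S X = lists S // syntactic_rel S X"

definition sofic_shift :: "'a set \<Rightarrow> (int \<Rightarrow> 'a) set \<Rightarrow> bool" where
  "sofic_shift S X \<longleftrightarrow> subshift S X \<and> finite (syntactic_classes S X)"

text \<open>Cellular automata are taken extensional (\<open>undefined\<close> off \<open>X\<close>), so that equality of
  automata is equality as maps on \<open>X\<close>.\<close>

definition cellular_automata ::
    "'a set \<Rightarrow> (int \<Rightarrow> 'a) set \<Rightarrow> ((int \<Rightarrow> 'a) \<Rightarrow> int \<Rightarrow> 'a) set" where
  "cellular_automata S X = {f \<in> X \<rightarrow>\<^sub>E X.
     continuous_map (subtopology (full_shift_topology S) X)
                    (subtopology (full_shift_topology S) X) f \<and>
     (\<forall>x\<in>X. f (shift x) = shift (f x))}"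

definition End :: "'a set \<Rightarrow> (int \<Rightarrow> 'a) set \<Rightarrow> ((int \<Rightarrow> 'a) \<Rightarrow> int \<Rightarrow> 'a) monoid" where
  "End S X = \<lparr>carrier = cellular_automata S X,
              monoid.mult = (\<lambda>f g. compose X f g),
              one = (\<lambda>x\<in>X. x)\<rparr>"

lemma topspace_full_shift_topology [simp]: "topspace (full_shift_topology S) = full_shift S"
  by (simp add: full_shift_topology_def full_shift_def)

lemma subshift_full_shift: "subshift S (full_shift S)"
proof -
  have "shift ` full_shift S = full_shift S"
  proof
    show "full_shift S \<subseteq> shift ` full_shift S"
    proof
      fix x assume "x \<in> full_shift S"
      then have "(\<lambda>i. x (i - 1)) \<in> full_shift S" and "x = shift (\<lambda>i. x (i - 1))"
        by (auto simp: full_shift_def shift_def)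
      then show "x \<in> shift ` full_shift S" by blast
    qed
  qed (auto simp: full_shift_def shift_def)
  moreover have "closedin (full_shift_topology S) (full_shift S)"
    by (metis closedin_topspace topspace_full_shift_topology)
  ultimately show ?thesis by (simp add: subshift_def)
qed

lemma equiv_syntactic_rel: "equiv (lists S) (syntactic_rel S X)"
  by (rule equivI) (auto simp: syntactic_rel_def refl_on_def sym_def trans_def)

lemma monoid_End:
  assumes "subshift S X"
  shows "monoid (End S X)"
proof -
  let ?T = "subtopology (full_shift_topology S) X"
  have top: "topspace ?T = X"
    using assms closedin_subset by (fastforce simp: subshift_def)
  have sh: "shift x \<in> X" if "x \<in> X" for x
    using assms that by (auto simp: subshift_def)
  have "compose X f g \<in> cellular_automata S X"
    if f: "f \<in> cellular_automata S X" and g: "g \<in> cellular_automata S X" for f g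
  proof -
    have "continuous_map ?T ?T (f \<circ> g)"
      using f g by (auto simp: cellular_automata_def intro: continuous_map_compose)
    then have "continuous_map ?T ?T (compose X f g)"
      by (rule continuous_map_eq) (simp add: top compose_def)
    moreover have "g x \<in> X" "f x \<in> X" if "x \<in> X" for x
      using f g that by (auto simp: cellular_automata_def)
    ultimately show ?thesis
      using f g sh by (auto simp: cellular_automata_def compose_def)
  qed
  moreover have "(\<lambda>x\<in>X. x) \<in> cellular_automata S X"
  proof -
    have "continuous_map ?T ?T (\<lambda>x\<in>X. x)"
      using continuous_map_id by (rule continuous_map_eq) (simp add: top)
    then show ?thesis using sh by (auto simp: cellular_automata_def)
  qed
  moreover have "compose X (compose X f g) h = compose X f (compose X g h)"
    if "h \<in> cellular_automata S X" for f g h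
    using that by (intro compose_assoc[symmetric]) (auto simp: cellular_automata_def)
  moreover have "compose X (\<lambda>x\<in>X. x) f = f" "compose X f (\<lambda>x\<in>X. x) = f"
    if "f \<in> cellular_automata S X" for f
    using that by (auto simp: cellular_automata_def PiE_def intro!: Id_compose compose_Id)
  ultimately show ?thesis
    by (auto simp: monoid_def End_def)
qed

end

theory Submission
  imports Defs "HOL-Library.Ramsey"
begin

text \<open>
  The idea is to let cellular automata on \<open>A\<close> act on data hidden in the points of \<open>X\<close>.  Choose a
  family of words of one length, indexed by \<open>A \<times> A\<close>, that are pairwise syntactically equivalent
  and such that no two of them, equal or not, can overlap.  Equivalence means that every occurrence
  of a code word in a point of \<open>X\<close> may be exchanged for any other code word without leaving \<open>X\<close>
  (\<open>put_in\<close>); the absence of overlaps means that such exchanges neither destroy nor create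
  occurrences (\<open>occ_put\<close>).  So a point of \<open>X\<close> is a fixed skeleton together with a freely
  changeable pair of letters at each occurrence.

  The letters are arranged on conveyor belts.  Occurrences at a fixed distance \<open>N\<close> are neighbours.
  In a maximal run of neighbours the first letters are read from left to right and the second
  letters from right to left, and at an end of the run one turns around onto the other track.  A
  finite run is then a periodic configuration over \<open>A\<close>, a run that is infinite on one side is a
  single bi-infinite configuration, and a run that is infinite on both sides carries two of them.  An
  automaton \<open>f\<close> acts by applying \<open>f\<close> to all these configurations.  One step along a belt
  moves by at most \<open>N\<close>, so the action is again local; and because the belts of the new point
  are the \<open>f\<close>-images of the old ones (\<open>belt_act\<close>), composition is respected.  If \<open>X\<close> contains a
  point with occurrences at all multiples of \<open>N\<close>, every configuration over \<open>A\<close> is realised on a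
  belt, and \<open>f\<close> can be recovered from its action (\<open>act_injective\<close>).

  Such a code exists because \<open>X\<close> is uncountable.  By Ramsey's theorem each half of a point of \<open>X\<close>
  can be cut into pieces lying in one idempotent class of the syntactic monoid.  If the words of
  every such class commuted, every point would be eventually periodic in both directions and \<open>X\<close>
  would be countable.  Hence some idempotent class contains two distinct words \<open>p\<close>, \<open>q\<close> of equal
  length (\<open>uncountable_sofic_words\<close>), and then all products of \<open>p\<close> and \<open>q\<close> lie in that class.
  A combinatorial construction cuts the code words out of such products
  (\<open>nonoverlapping_code\<close>).
\<close>

section \<open>Configurations and finite windows\<close>

definition agree :: "int \<Rightarrow> (int \<Rightarrow> 's) \<Rightarrow> (int \<Rightarrow> 's) \<Rightarrow> bool" where
  "agree m x y \<longleftrightarrow> (\<forall>i. \<bar>i\<bar> \<le> m \<longrightarrow> x i = y i)"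

lemma agree_mono: "agree m x y \<Longrightarrow> k \<le> m \<Longrightarrow> agree k x y"
  by (auto simp: agree_def)

lemma in_full_shift_iff: "x \<in> full_shift S \<longleftrightarrow> (\<forall>i. x i \<in> S)"
  by (auto simp: full_shift_def PiE_iff)

lemma openin_full_shift_topology:
  "openin (full_shift_topology S) V \<longleftrightarrow>
     V \<subseteq> full_shift S \<and> (\<forall>x\<in>V. \<exists>m. \<forall>y\<in>full_shift S. agree m x y \<longrightarrow> y \<in> V)"
  (is "?L \<longleftrightarrow> ?R")
proof
  assume L: ?L
  have "\<exists>m. \<forall>y\<in>full_shift S. agree m x y \<longrightarrow> y \<in> V" if "x \<in> V" for x
  proof -
    obtain U where U: "finite {i. U i \<noteq> S}" "x \<in> Pi\<^sub>E UNIV U" "Pi\<^sub>E UNIV U \<subseteq> V"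
      using L \<open>x \<in> V\<close> unfolding full_shift_topology_def openin_product_topology_alt
      by auto
    define m where "m = Max (insert 0 (abs ` {i. U i \<noteq> S}))"
    have m: "\<bar>i\<bar> \<le> m" if "U i \<noteq> S" for i
      unfolding m_def using U(1) that by (intro Max_ge) auto
    have "y \<in> V" if "y \<in> full_shift S" "agree m x y" for y
    proof -
      have "y i \<in> U i" for i
      proof (cases "U i = S")
        case True
        then show ?thesis using that by (auto simp: full_shift_def)
      next
        case False
        then show ?thesis using m that U(2) by (metis PiE_mem UNIV_I agree_def)
      qed
      then show ?thesis using U(3) by auto
    qed
    then show ?thesis by blast
  qed
  moreover have "V \<subseteq> full_shift S" using openin_subset[OF L] by simp
  ultimately show ?R by blast
next
  assume R: ?R
  have "\<exists>U. finite {i. U i \<noteq> S} \<and> (\<forall>i. U i \<subseteq> S) \<and> x \<in> Pi\<^sub>E UNIV U \<and> Pi\<^sub>E UNIV U \<subseteq> V"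
    if "x \<in> V" for x
  proof -
    obtain m where m: "\<forall>y\<in>full_shift S. agree m x y \<longrightarrow> y \<in> V"
      using R \<open>x \<in> V\<close> by blast
    define U where "U = (\<lambda>i. if \<bar>i\<bar> \<le> m then {x i} else S)"
    have "x \<in> full_shift S" using conjunct1[OF R] that by blast
    then have xS: "x i \<in> S" for i by (auto simp: full_shift_def)
    have "finite {i. U i \<noteq> S}"
      by (rule finite_subset[of _ "{-m..m}"]) (auto simp: U_def split: if_splits)
    moreover have US: "U i \<subseteq> S" for i using xS by (auto simp: U_def)
    moreover have "x \<in> Pi\<^sub>E UNIV U" using xS by (auto simp: U_def)
    moreover have "Pi\<^sub>E UNIV U \<subseteq> V"
    proof
      fix y assume y: "y \<in> Pi\<^sub>E UNIV U"
      then have yU: "y i \<in> U i" for i by auto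
      then have "agree m x y" unfolding agree_def U_def by (metis singletonD)
      moreover have "y \<in> full_shift S" using yU US by (auto simp: full_shift_def)
      ultimately show "y \<in> V" using m by blast
    qed
    ultimately show ?thesis by blast
  qed
  then show ?L unfolding full_shift_topology_def openin_product_topology_alt
    by simp
qed

lemma openin_subspace:
  assumes "X \<subseteq> full_shift S"
  shows "openin (subtopology (full_shift_topology S) X) V \<longleftrightarrow>
     V \<subseteq> X \<and> (\<forall>x\<in>V. \<exists>m. \<forall>y\<in>X. agree m x y \<longrightarrow> y \<in> V)" (is "?L \<longleftrightarrow> ?R")
proof
  assume ?L
  then obtain T where T: "openin (full_shift_topology S) T" "V = T \<inter> X"
    unfolding openin_subtopology by blast
  show ?R
  proof (intro conjI ballI)
    fix x assume "x \<in> V"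
    then obtain m where "\<forall>y\<in>full_shift S. agree m x y \<longrightarrow> y \<in> T"
      using T unfolding openin_full_shift_topology by blast
    then show "\<exists>m. \<forall>y\<in>X. agree m x y \<longrightarrow> y \<in> V" using T(2) assms by blast
  qed (use T in blast)
next
  assume R: ?R
  define T where "T = {y \<in> full_shift S. \<exists>x\<in>V. \<exists>m. agree m x y \<and> (\<forall>z\<in>X. agree m x z \<longrightarrow> z \<in> V)}"
  have "openin (full_shift_topology S) T"
    unfolding openin_full_shift_topology
  proof (intro conjI ballI)
    fix y assume "y \<in> T"
    then obtain x m where xm: "x \<in> V" "agree m x y" "\<forall>z\<in>X. agree m x z \<longrightarrow> z \<in> V"
      by (auto simp: T_def)
    have "z \<in> T" if "z \<in> full_shift S" "agree m y z" for z
    proof -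
      have "agree m x z" using xm(2) that(2) by (simp add: agree_def)
      then show ?thesis using xm(1,3) that(1) unfolding T_def by blast
    qed
    then show "\<exists>m. \<forall>z\<in>full_shift S. agree m y z \<longrightarrow> z \<in> T" by blast
  qed (auto simp: T_def)
  moreover have "V = T \<inter> X"
  proof
    show "V \<subseteq> T \<inter> X"
    proof
      fix x assume x: "x \<in> V"
      then obtain m where "\<forall>y\<in>X. agree m x y \<longrightarrow> y \<in> V" using R by blast
      then show "x \<in> T \<inter> X" using x R assms by (auto simp: T_def agree_def)
    qed
  qed (auto simp: T_def)
  ultimately show ?L unfolding openin_subtopology by blast
qed

text \<open>The window may depend on the point: this is continuity for the product topology read off
  coordinate by coordinate, in the form in which belts and their contents can be followed
  from a point to its neighbours.\<close>
lemma continuous_map_iff_local: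
  assumes X: "X \<subseteq> full_shift S" and f: "f \<in> X \<rightarrow> X"
  shows "continuous_map (subtopology (full_shift_topology S) X)
           (subtopology (full_shift_topology S) X) f \<longleftrightarrow>
         (\<forall>x\<in>X. \<forall>j. \<exists>m. \<forall>y\<in>X. agree m x y \<longrightarrow> f y j = f x j)"
    (is "?L \<longleftrightarrow> ?R")
proof -
  have top: "topspace (subtopology (full_shift_topology S) X) = X" using X by auto
  show ?thesis
  proof
    assume L: ?L
    show ?R
    proof (intro ballI allI)
      fix x j assume x: "x \<in> X"
      have "openin (subtopology (full_shift_topology S) X) {z\<in>X. z j = f x j}"
        unfolding openin_subspace[OF X]
        by (auto simp: agree_def intro!: exI[of _ "\<bar>j\<bar>"])
      then have "openin (subtopology (full_shift_topology S) X) {y\<in>X. f y \<in> {z\<in>X. z j = f x j}}"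
        using openin_continuous_map_preimage[OF L] unfolding top by blast
      then obtain m where "\<forall>y\<in>X. agree m x y \<longrightarrow> y \<in> {y\<in>X. f y \<in> {z\<in>X. z j = f x j}}"
        unfolding openin_subspace[OF X] using x f by blast
      then show "\<exists>m. \<forall>y\<in>X. agree m x y \<longrightarrow> f y j = f x j" by blast
    qed
  next
    assume R: ?R
    show ?L
      unfolding continuous_map_def top
    proof (intro conjI allI impI)
      fix V assume V: "openin (subtopology (full_shift_topology S) X) V"
      show "openin (subtopology (full_shift_topology S) X) {x \<in> X. f x \<in> V}"
        unfolding openin_subspace[OF X]
      proof (intro conjI ballI)
        fix x assume "x \<in> {x \<in> X. f x \<in> V}"
        then have x: "x \<in> X" "f x \<in> V" by auto
        obtain m where m: "\<forall>z\<in>X. agree m (f x) z \<longrightarrow> z \<in> V"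
          using V x(2) unfolding openin_subspace[OF X] by blast
        obtain M where M: "\<And>j y. y \<in> X \<Longrightarrow> agree (M j) x y \<Longrightarrow> f y j = f x j"
          using R x(1) by metis
        define K where "K = Max (insert 0 (M ` {-m..m}))"
        have K: "M j \<le> K" if "\<bar>j\<bar> \<le> m" for j
        proof -
          have "M j \<in> M ` {-m..m}" using that by (intro imageI) auto
          then show ?thesis unfolding K_def by (intro Max_ge) auto
        qed
        have "y \<in> {x \<in> X. f x \<in> V}" if y: "y \<in> X" "agree K x y" for y
        proof -
          have "agree m (f x) (f y)"
            unfolding agree_def using M y K agree_mono by metis
          then show ?thesis using m y(1) f by auto
        qed
        then show "\<exists>m. \<forall>y\<in>X. agree m x y \<longrightarrow> y \<in> {x \<in> X. f x \<in> V}" by blast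
      qed blast
    qed (use f in auto)
  qed
qed

lemma subshift_subset: "subshift S X \<Longrightarrow> X \<subseteq> full_shift S"
  using closedin_subset by (fastforce simp: subshift_def)

lemma subshift_limit:
  assumes X: "subshift S X" and y: "y \<in> full_shift S"
    and lim: "\<And>m. \<exists>z\<in>X. agree m y z"
  shows "y \<in> X"
proof (rule ccontr)
  assume "y \<notin> X"
  have "openin (full_shift_topology S) (full_shift S - X)"
    using X by (auto simp: subshift_def closedin_def)
  then obtain m where "\<forall>z\<in>full_shift S. agree m y z \<longrightarrow> z \<in> full_shift S - X"
    using y \<open>y \<notin> X\<close> unfolding openin_full_shift_topology by blast
  then show False using lim[of m] subshift_subset[OF X] by blast
qed

lemma subshift_translate:
  assumes X: "subshift S X" and x: "x \<in> X"
  shows "(\<lambda>j. x (j + i)) \<in> X"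
proof (induction i rule: int_induct[where k = 0])
  case base
  then show ?case using x by simp
next
  case (step1 i)
  have "shift ` X = X" using X by (simp add: subshift_def)
  then have "shift (\<lambda>j. x (j + i)) \<in> X" using step1(2) by blast
  then show ?case by (simp add: shift_def algebra_simps)
next
  case (step2 i)
  have "shift ` X = X" using X by (simp add: subshift_def)
  then obtain z where z: "z \<in> X" "(\<lambda>j. x (j + i)) = shift z" using step2(2) by blast
  have "x (j + (i - 1)) = z j" for j
    using fun_cong[OF z(2), of "j - 1"] by (simp add: shift_def algebra_simps)
  then show ?case using z(1) by simp
qed

section \<open>Words and the syntactic congruence\<close>

definition segment :: "(int \<Rightarrow> 's) \<Rightarrow> int \<Rightarrow> nat \<Rightarrow> 's list" where
  "segment x i k = map (\<lambda>t. x (i + int t)) [0..<k]"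

lemma length_segment [simp]: "length (segment x i k) = k"
  by (simp add: segment_def)

lemma nth_segment [simp]: "t < k \<Longrightarrow> segment x i k ! t = x (i + int t)"
  by (simp add: segment_def)

lemma segment_append: "segment x i (k + l) = segment x i k @ segment x (i + int k) l"
  by (rule nth_equalityI) (auto simp: nth_append)

lemma segment_in_lists: "x \<in> full_shift S \<Longrightarrow> segment x i k \<in> lists S"
  by (auto simp: segment_def full_shift_def PiE_iff)

lemma segment_in_language: "x \<in> X \<Longrightarrow> segment x i k \<in> language X"
  by (auto simp: language_def occurs_in_def)

lemma language_obtain_at:
  assumes "subshift S X" "w \<in> language X"
  obtains z where "z \<in> X" "segment z i (length w) = w"
proof -
  obtain x j where x: "x \<in> X" "\<forall>k<length w. x (j + int k) = w ! k"
    using assms(2) by (auto simp: language_def occurs_in_def)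
  show thesis
  proof (rule that)
    show "(\<lambda>t. x (t + (j - i))) \<in> X" using subshift_translate[OF assms(1) x(1)] .
    show "segment (\<lambda>t. x (t + (j - i))) i (length w) = w"
      using x(2) by (intro nth_equalityI) (auto simp: algebra_simps)
  qed
qed

lemma syntactic_rel_language:
  assumes "(w, w') \<in> syntactic_rel S X"
  shows "w \<in> language X \<longleftrightarrow> w' \<in> language X"
proof -
  have "[] @ w @ [] \<in> language X \<longleftrightarrow> [] @ w' @ [] \<in> language X"
    using assms unfolding syntactic_rel_def by blast
  then show ?thesis by simp
qed

lemma syntactic_rel_lists:
  "(w, w') \<in> syntactic_rel S X \<Longrightarrow> w \<in> lists S \<and> w' \<in> lists S"
  by (simp add: syntactic_rel_def)

lemma syntactic_rel_refl: "w \<in> lists S \<Longrightarrow> (w, w) \<in> syntactic_rel S X"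
  by (simp add: syntactic_rel_def)

lemma syntactic_rel_sym: "(w, w') \<in> syntactic_rel S X \<Longrightarrow> (w', w) \<in> syntactic_rel S X"
  by (simp add: syntactic_rel_def)

lemma syntactic_rel_trans:
  "(w, w') \<in> syntactic_rel S X \<Longrightarrow> (w', w'') \<in> syntactic_rel S X \<Longrightarrow> (w, w'') \<in> syntactic_rel S X"
  by (simp add: syntactic_rel_def)

lemma syntactic_rel_append:
  assumes "(w, w') \<in> syntactic_rel S X" "(v, v') \<in> syntactic_rel S X"
  shows "(w @ v, w' @ v') \<in> syntactic_rel S X"
proof -
  have "a @ (w @ v) @ b \<in> language X \<longleftrightarrow> a @ (w' @ v') @ b \<in> language X"
    if a: "a \<in> lists S" and b: "b \<in> lists S" for a b
  proof -
    have L: "w \<in> lists S" "v \<in> lists S" "w' \<in> lists S" "v' \<in> lists S"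
      using assms by (auto simp: syntactic_rel_def)
    have "a @ w @ (v @ b) \<in> language X \<longleftrightarrow> a @ w' @ (v @ b) \<in> language X"
      using assms(1) a b L unfolding syntactic_rel_def by (simp del: append_assoc)
    also have "\<dots> \<longleftrightarrow> (a @ w') @ v @ b \<in> language X" by simp
    also have "\<dots> \<longleftrightarrow> (a @ w') @ v' @ b \<in> language X"
      using assms(2) a b L unfolding syntactic_rel_def by (simp del: append_assoc)
    finally show ?thesis by simp
  qed
  then show ?thesis using assms by (auto simp: syntactic_rel_def)
qed

text \<open>Syntactic equivalence speaks about finite words only; a whole point may be changed because
  each of its large windows has the form \<open>u @ w @ v\<close>, so the changed point is a limit of points
  of \<open>X\<close>.\<close>
lemma subshift_replace:
  assumes X: "subshift S X" and x: "x \<in> X" and rel: "(w, w') \<in> syntactic_rel S X"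
    and len: "length w' = length w" and occ: "segment x i (length w) = w"
  shows "(\<lambda>j. if i \<le> j \<and> j < i + int (length w) then w' ! nat (j - i) else x j) \<in> X"
    (is "?y \<in> X")
proof (rule subshift_limit[OF X])
  note XS = subshift_subset[OF X]
  have w': "w' \<in> lists S" using rel by (simp add: syntactic_rel_def)
  have "x j \<in> S" for j using XS x by (auto simp: in_full_shift_iff)
  moreover have "w' ! t \<in> S" if "t < length w" for t
    using w' that len by (metis in_listsD nth_mem)
  ultimately show "?y \<in> full_shift S"
    by (simp add: in_full_shift_iff nat_less_iff)
  fix m :: int
  define M where "M = nat (\<bar>m\<bar> + \<bar>i\<bar>) + length w"
  define k l where "k = nat (i + int M)" and "l = nat (int M + 1 - i - int (length w))"
  have k: "int k = i + int M" and l: "int l = int M + 1 - i - int (length w)"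
    unfolding k_def l_def M_def by auto
  define u v where "u = segment x (- int M) k" and "v = segment x (i + int (length w)) l"
  have uv: "u \<in> lists S" "v \<in> lists S"
    unfolding u_def v_def using XS x segment_in_lists by blast+
  have "segment x (- int M) (k + (length w + l)) = u @ w @ v"
    unfolding segment_append u_def v_def by (simp add: k occ)
  then have "u @ w @ v \<in> language X" using segment_in_language[OF x] by metis
  then have "u @ w' @ v \<in> language X"
    using rel uv by (simp add: syntactic_rel_def)
  then obtain z where z: "z \<in> X" "segment z (- int M) (length (u @ w' @ v)) = u @ w' @ v"
    using language_obtain_at[OF X] by metis
  have zk: "z (- int M + int t) = (u @ w' @ v) ! t" if "t < k + length w + l" for t
    using arg_cong[OF z(2), of "\<lambda>s. s ! t"] that len by (simp add: u_def v_def)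
  have "?y j = z j" if "\<bar>j\<bar> \<le> m" for j
  proof -
    define t where "t = nat (j + int M)"
    have t: "int t = j + int M" using that unfolding t_def M_def by auto
    have "t < k + length w + l" using that k l t unfolding M_def by linarith
    then have "z j = (u @ w' @ v) ! t" using zk[of t] t by simp
    also have "\<dots> = ?y j"
      using t k l len \<open>t < _\<close>
      by (auto simp: nth_append u_def v_def nat_diff_distrib intro!: arg_cong[of _ _ x] arg_cong[of _ _ "(!) w'"])
    finally show ?thesis by simp
  qed
  then show "\<exists>z\<in>X. agree m ?y z" using z(1) unfolding agree_def by blast
qed

section \<open>Non-commuting words in an uncountable sofic shift\<close>

text \<open>Such a point is determined by the two thresholds, the two periods and a finite middle part.\<close>
lemma countable_eventually_periodic:
  assumes "finite S"
  shows "countable {x \<in> full_shift S.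
    (\<exists>a p. 0 < p \<and> (\<forall>t\<ge>a. x (t + p) = x t)) \<and> (\<exists>b q. 0 < q \<and> (\<forall>t\<le>b. x (t - q) = x t))}"
    (is "countable ?P")
proof -
  define E where "E = (\<lambda>(a, p, b, q). {x \<in> full_shift S.
    0 < p \<and> (\<forall>t\<ge>a. x (t + p) = x t) \<and> 0 < q \<and> (\<forall>t\<le>b. x (t - q) = x t)})"
  have fin: "finite (E c)" for c
  proof -
    obtain a p b q where c: "c = (a, p, b, q)" by (cases c)
    define N where "N = \<bar>a\<bar> + \<bar>b\<bar> + \<bar>p\<bar> + \<bar>q\<bar>"
    have eq: "x t = y t"
      if x: "x \<in> E c" and y: "y \<in> E c" and xy: "\<forall>t\<in>{-N..N}. x t = y t" for x y t
    proof (induction "nat \<bar>t\<bar>" arbitrary: t rule: less_induct)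
      case less
      have pq: "0 < p" "0 < q" using x by (auto simp: E_def c)
      consider "t \<in> {-N..N}" | "t > N" | "t < - N" by fastforce
      then show ?case
      proof cases
        case 1
        then show ?thesis using xy by blast
      next
        case 2
        then have "t - p \<ge> a" "\<bar>t - p\<bar> < \<bar>t\<bar>" using pq unfolding N_def by linarith+
        moreover have "x (t - p + p) = x (t - p)" "y (t - p + p) = y (t - p)"
          using x y \<open>t - p \<ge> a\<close> unfolding E_def c by blast+
        ultimately show ?thesis using less[of "t - p"] by simp
      next
        case 3
        then have "t + q \<le> b" "\<bar>t + q\<bar> < \<bar>t\<bar>" using pq unfolding N_def by linarith+
        moreover have "x (t + q - q) = x (t + q)" "y (t + q - q) = y (t + q)"
          using x y \<open>t + q \<le> b\<close> unfolding E_def c by blast+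
        ultimately show ?thesis using less[of "t + q"] by simp
      qed
    qed
    have "inj_on (\<lambda>x. restrict x {-N..N}) (E c)"
    proof (rule inj_onI, rule ext)
      fix x y t
      assume xy: "x \<in> E c" "y \<in> E c" and r: "restrict x {-N..N} = restrict y {-N..N}"
      have "\<forall>t\<in>{-N..N}. x t = y t" using r by (metis restrict_apply')
      then show "x t = y t" using eq[OF xy] by blast
    qed
    moreover have "(\<lambda>x. restrict x {-N..N}) ` E c \<subseteq> {-N..N} \<rightarrow>\<^sub>E S"
      by (auto simp: E_def c in_full_shift_iff)
    moreover have "finite ({-N..N} \<rightarrow>\<^sub>E S)" using assms by (intro finite_PiE) auto
    ultimately show ?thesis using finite_imageD finite_subset by blast
  qed
  have "?P \<subseteq> (\<Union>c. E c)"
  proof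
    fix x assume "x \<in> ?P"
    then obtain a p b q where "x \<in> E (a, p, b, q)" unfolding E_def by auto
    then show "x \<in> (\<Union>c. E c)" by blast
  qed
  moreover have "countable (\<Union>c. E c)" 
    by (rule countable_UN) (simp_all add: countable_finite[OF fin])
  ultimately show ?thesis by (rule countable_subset)
qed

text \<open>Reading the word as \<open>z @ w\<close> shows \<open>w\<close> at distance \<open>length z\<close>, reading it as \<open>w @ z\<close> shows
  \<open>w\<close> at the start; so commutation is periodicity with period \<open>length z\<close>.\<close>
lemma period_of_commuting_factorisation:
  assumes "segment x i (length z + length w) = z @ w" "z @ w = w @ z" "r < length w"
  shows "x (i + int (r + length z)) = x (i + int r)"
proof -
  have nth: "x (i + int t) = (z @ w) ! t" if "t < length z + length w" for t
    using that assms(1) by (metis nth_segment)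
  have "x (i + int (r + length z)) = (z @ w) ! (r + length z)" using assms(3) by (intro nth) simp
  also have "\<dots> = w ! r" by (simp add: nth_append)
  also have "\<dots> = (w @ z) ! r" using assms(3) by (simp add: nth_append)
  also have "\<dots> = (z @ w) ! r" using assms(2) by simp
  also have "\<dots> = x (i + int r)" using assms(3) by (intro nth[symmetric]) simp
  finally show ?thesis .
qed

text \<open>Ramsey's theorem, with the pair \<open>i < j\<close> of cut positions coloured by the syntactic class of
  the word between them.  The common class is idempotent, since a word between two cuts is also a
  product of two such words as soon as there is a cut in between.\<close>
lemma homogeneous_cut_points:
  assumes fin: "finite (syntactic_classes S X)" and x: "x \<in> full_shift S" and H0: "infinite H0"
  obtains H where "H \<subseteq> H0" "infinite H"
    "\<And>i j i' j'. \<lbrakk>i \<in> H; j \<in> H; i' \<in> H; j' \<in> H; i < j; i' < j'\<rbrakk> \<Longrightarrow>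
       (segment x i (nat (j - i)), segment x i' (nat (j' - i'))) \<in> syntactic_rel S X"
proof -
  let ?C = "syntactic_classes S X" and ?R = "syntactic_rel S X"
  obtain h where h: "bij_betw h ?C {0..<card ?C}"
    using ex_bij_betw_finite_nat[OF fin] by blast
  define cl where "cl = (\<lambda>i j. ?R `` {segment x i (nat (j - i))})"
  have cl: "cl i j \<in> ?C" for i j
    unfolding cl_def syntactic_classes_def using segment_in_lists[OF x] by (rule quotientI)
  define f where "f = (\<lambda>e. h (cl (Min e) (Max e)))"
  have "\<forall>i\<in>H0. \<forall>j\<in>H0. i \<noteq> j \<longrightarrow> f {i, j} < card ?C"
    using cl h unfolding f_def bij_betw_def by fastforce
  from Ramsey2[OF H0 this] obtain H t where H: "H \<subseteq> H0" "infinite H"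
    and t: "\<forall>i\<in>H. \<forall>j\<in>H. i \<noteq> j \<longrightarrow> f {i, j} = t" by blast
  show thesis
  proof (rule that[OF H])
    fix i j i' j' assume ij: "i \<in> H" "j \<in> H" "i' \<in> H" "j' \<in> H" "i < j" "i' < j'"
    have "f {i, j} = f {i', j'}" using t ij by (metis less_irrefl)
    then have "h (cl i j) = h (cl i' j')" using ij(5,6) by (simp add: f_def max_def min_def)
    then have "cl i j = cl i' j'" using h cl by (metis bij_betw_def inj_onD)
    then show "(segment x i (nat (j - i)), segment x i' (nat (j' - i'))) \<in> ?R"
      unfolding cl_def
      using eq_equiv_class[OF _ equiv_syntactic_rel segment_in_lists[OF x]] by blast
  qed
qed

lemma segment_join:
  "i \<le> j \<Longrightarrow> j \<le> k \<Longrightarrow> segment x i (nat (k - i)) = segment x i (nat (j - i)) @ segment x j (nat (k - j))"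
  using segment_append[of x i "nat (j - i)" "nat (k - j)"]
  by (simp add: nat_add_distrib[symmetric])

text \<open>If no such pair existed, any two words \<open>z\<close>, \<open>w\<close> between consecutive homogeneous cuts would
  commute, because \<open>z @ w\<close> and \<open>w @ z\<close> have equal length and the same idempotent class.  Fixing
  two cuts and letting a third one tend to infinity, in either direction, makes each point
  eventually periodic, so that \<open>X\<close> is countable.\<close>
lemma uncountable_sofic_words:
  assumes S: "finite S" and X: "sofic_shift S X" and unc: "uncountable X"
  obtains p q where "p \<noteq> q" "length p = length q" "p \<in> language X"
    "(p, q) \<in> syntactic_rel S X" "(p @ p, p) \<in> syntactic_rel S X"
proof (rule ccontr)
  note witness = that
  assume "\<not> thesis"
  then have C: "p = q" if "length p = length q" "p \<in> language X"
    "(p, q) \<in> syntactic_rel S X" "(p @ p, p) \<in> syntactic_rel S X" for p q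
    using witness that by blast
  have sub: "subshift S X" and fin: "finite (syntactic_classes S X)"
    using X by (auto simp: sofic_shift_def)
  note XS = subshift_subset[OF sub]
  have "(\<exists>a p. 0 < p \<and> (\<forall>t\<ge>a. x (t + p) = x t)) \<and> (\<exists>b q. 0 < q \<and> (\<forall>t\<le>b. x (t - q) = x t))"
    if x: "x \<in> X" for x
  proof -
    have xS: "x \<in> full_shift S" using x XS by blast
    have commute: "segment x i (nat (j - i)) @ segment x j (nat (k - j)) =
        segment x j (nat (k - j)) @ segment x i (nat (j - i))"
      if rel: "\<And>i j i' j'. \<lbrakk>i \<in> H; j \<in> H; i' \<in> H; j' \<in> H; i < j; i' < j'\<rbrakk> \<Longrightarrow>
          (segment x i (nat (j - i)), segment x i' (nat (j' - i'))) \<in> syntactic_rel S X"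
        and ijk: "i \<in> H" "j \<in> H" "k \<in> H" "i < j" "j < k"
      for H i j k
    proof -
      define z w where "z = segment x i (nat (j - i))" and "w = segment x j (nat (k - j))"
      have zw: "z @ w = segment x i (nat (k - i))"
        unfolding z_def w_def using segment_join ijk by (metis less_imp_le)
      have r1: "(z, w) \<in> syntactic_rel S X" unfolding z_def w_def using ijk by (intro rel)
      have r2: "(z, z @ w) \<in> syntactic_rel S X" unfolding zw unfolding z_def using ijk by (intro rel) auto
      have zz: "(z, z) \<in> syntactic_rel S X" using r1 syntactic_rel_sym syntactic_rel_trans by blast
      have "(z @ z, z @ w) \<in> syntactic_rel S X" by (rule syntactic_rel_append[OF zz r1])
      moreover have "(z @ z, w @ z) \<in> syntactic_rel S X" by (rule syntactic_rel_append[OF r1 zz])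
      ultimately have a: "(z @ w, w @ z) \<in> syntactic_rel S X" and b: "(z @ z, z) \<in> syntactic_rel S X"
        using r2 syntactic_rel_sym syntactic_rel_trans by blast+
      have "((z @ w) @ (z @ w), z @ z) \<in> syntactic_rel S X"
        using syntactic_rel_append[OF syntactic_rel_sym[OF r2] syntactic_rel_sym[OF r2]] .
      then have c: "((z @ w) @ (z @ w), z @ w) \<in> syntactic_rel S X"
        using b r2 syntactic_rel_trans by blast
      have "z @ w \<in> language X" unfolding zw by (rule segment_in_language[OF x])
      then show ?thesis using C[OF _ _ a c] unfolding z_def w_def by simp
    qed
    have "\<exists>a p. 0 < p \<and> (\<forall>t\<ge>a. x (t + p) = x t)"
    proof -
      obtain H where H: "H \<subseteq> {0..}" "infinite H" and
        rel: "\<And>i j i' j'. \<lbrakk>i \<in> H; j \<in> H; i' \<in> H; j' \<in> H; i < j; i' < j'\<rbrakk> \<Longrightarrow>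
          (segment x i (nat (j - i)), segment x i' (nat (j' - i'))) \<in> syntactic_rel S X"
        using homogeneous_cut_points[OF fin xS infinite_Ici[of 0]] by metis
      have big: "\<exists>k\<in>H. B < k" for B
      proof (rule ccontr)
        assume "\<not> (\<exists>k\<in>H. B < k)"
        then have "H \<subseteq> {0..B}" using H(1) by fastforce
        then show False using H(2) finite_subset by blast
      qed
      obtain i where i: "i \<in> H" using big by blast
      obtain j where j: "j \<in> H" "i < j" using big by blast
      have "x (t + (j - i)) = x t" if "t \<ge> i" for t
      proof -
        obtain k where k: "k \<in> H" "max j (t + (j - i)) < k" using big by blast
        define z w where "z = segment x i (nat (j - i))" and "w = segment x j (nat (k - j))"
        have com: "z @ w = w @ z"
          unfolding z_def w_def using commute[OF rel i j(1) k(1)] k j by simp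
        have "segment x i (length z + length w) = z @ w"
          using j unfolding z_def w_def by (simp add: segment_append)
        then have "x (i + int (nat (t - i) + length z)) = x (i + int (nat (t - i)))"
          by (rule period_of_commuting_factorisation[OF _ com])
            (use k j that in \<open>auto simp: w_def\<close>)
        then show ?thesis using that j by (simp add: z_def algebra_simps)
      qed
      then show ?thesis using j(2) by (intro exI[of _ i] exI[of _ "j - i"]) auto
    qed
    moreover have "\<exists>b q. 0 < q \<and> (\<forall>t\<le>b. x (t - q) = x t)"
    proof -
      obtain H where H: "H \<subseteq> {..0}" "infinite H" and
        rel: "\<And>i j i' j'. \<lbrakk>i \<in> H; j \<in> H; i' \<in> H; j' \<in> H; i < j; i' < j'\<rbrakk> \<Longrightarrow>
          (segment x i (nat (j - i)), segment x i' (nat (j' - i'))) \<in> syntactic_rel S X"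
        using homogeneous_cut_points[OF fin xS infinite_Iic[of 0]] by metis
      have small: "\<exists>k\<in>H. k < B" for B
      proof (rule ccontr)
        assume "\<not> (\<exists>k\<in>H. k < B)"
        then have "H \<subseteq> {B..0}" using H(1) by fastforce
        then show False using H(2) finite_subset by blast
      qed
      obtain k where k: "k \<in> H" using small by blast
      obtain j where j: "j \<in> H" "j < k" using small by blast
      have "x (t - (k - j)) = x t" if "t \<le> j" for t
      proof -
        obtain i where i: "i \<in> H" "i < min j (t - (k - j))" using small by blast
        define z w where "z = segment x j (nat (k - j))" and "w = segment x i (nat (j - i))"
        have com: "w @ z = z @ w"
          unfolding z_def w_def using commute[OF rel i(1) j(1) k] i j by simp
        have "segment x i (length w + length z) = w @ z"
          using i unfolding z_def w_def by (simp add: segment_append)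
        then have "segment x i (length z + length w) = z @ w" using com by (simp add: add.commute)
        then have "x (i + int (nat (t - (k - j) - i) + length z)) = x (i + int (nat (t - (k - j) - i)))"
          by (rule period_of_commuting_factorisation[OF _ com[symmetric]])
            (use i j that in \<open>auto simp: w_def\<close>)
        then show ?thesis using i j by (simp add: z_def algebra_simps)
      qed
      then show ?thesis using j(2) by (intro exI[of _ j] exI[of _ "k - j"]) auto
    qed
    ultimately show ?thesis by blast
  qed
  then have "X \<subseteq> {x \<in> full_shift S. (\<exists>a p. 0 < p \<and> (\<forall>t\<ge>a. x (t + p) = x t)) \<and>
      (\<exists>b q. 0 < q \<and> (\<forall>t\<le>b. x (t - q) = x t))}" using XS by blast
  then show False using countable_eventually_periodic[OF S] unc countable_subset by blast
qed

section \<open>A non-overlapping code over two words of equal length\<close>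

lemma concat_map_uniform:
  assumes "\<And>k. length (f k) = l" "j < n * l"
  shows "concat (map f [0..<n]) ! j = f (j div l) ! (j mod l)"
  using assms(2)
proof (induction n)
  case (Suc n)
  have len: "length (concat (map f [0..<n])) = n * l"
    using assms(1) by (induction n) auto
  show ?case
  proof (cases "j < n * l")
    case True
    then show ?thesis using Suc.IH len by (simp add: nth_append)
  next
    case False
    then have "j div l = n" using Suc.prems by (intro div_nat_eqI) (auto simp: algebra_simps)
    moreover from calculation have "j mod l = j - n * l" by (simp add: modulo_nat_def)
    ultimately show ?thesis using False len by (simp add: nth_append)
  qed
qed simp

text \<open>The starting point of the lexicographically least rotation of \<open>z\<close>, letters being compared by
  \<open>rank\<close>.  The conclusion is the defining property of that rotation, stated for the first position
  at which another rotation may differ.\<close>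
lemma minimal_rotation:
  fixes z :: "'a list" and rank :: "'a \<Rightarrow> nat"
  assumes "z \<noteq> []"
  obtains s where "s < length z"
    "\<And>x t. \<lbrakk>t < length z; \<And>i. i < t \<Longrightarrow> z ! ((s + i) mod length z) = z ! ((x + i) mod length z)\<rbrakk>
       \<Longrightarrow> rank (z ! ((s + t) mod length z)) \<le> rank (z ! ((x + t) mod length z))"
proof -
  define l where "l = length z"
  define rot where "rot = (\<lambda>x. map (\<lambda>i. rank (z ! ((x + i) mod l))) [0..<l])"
  have l: "0 < l" using assms by (simp add: l_def)
  have "rot 0 \<in> rot ` {..<l}" using l by blast
  then obtain m where m: "m \<in> rot ` {..<l}"
    and min: "\<And>y. (y, m) \<in> lenlex less_than \<Longrightarrow> y \<notin> rot ` {..<l}"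
    using wfE_min[OF wf_lenlex[OF wf_less_than]] by metis
  then obtain s where s: "s < l" "m = rot s" by blast
  show thesis
  proof (rule that)
    show "s < length z" using s l_def by simp
    fix x t
    assume t: "t < length z"
      and eq: "\<And>i. i < t \<Longrightarrow> z ! ((s + i) mod length z) = z ! ((x + i) mod length z)"
    show "rank (z ! ((s + t) mod length z)) \<le> rank (z ! ((x + t) mod length z))"
    proof (rule ccontr)
      assume "\<not> ?thesis"
      then have less: "rot x ! t < rot s ! t" using t by (simp add: rot_def l_def)
      have tl: "t < length (rot x)" "t < length (rot s)" using t by (auto simp: rot_def l_def)
      have pre: "take t (rot x) = take t (rot s)"
        using eq t by (intro nth_equalityI) (auto simp: rot_def l_def)
      have "rot x = take t (rot s) @ rot x ! t # drop (Suc t) (rot x)"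
        using id_take_nth_drop[OF tl(1)] pre by simp
      moreover have "rot s = take t (rot s) @ rot s ! t # drop (Suc t) (rot s)"
        using id_take_nth_drop[OF tl(2)] .
      ultimately have "(rot x, rot s) \<in> lenlex less_than"
        unfolding lenlex_conv lex_conv using less by (auto simp: rot_def)
      moreover have "rot x = rot (x mod l)" by (simp add: rot_def mod_add_left_eq)
      ultimately show False using min s l by (metis imageI lessThan_iff mod_less_divisor)
    qed
  qed
qed

text \<open>Let \<open>p = c @ a # p'\<close> and \<open>q = c @ b # q'\<close> with \<open>a \<noteq> b\<close>.  A code word is cut out of a product of
  blocks \<open>p\<close>, \<open>q\<close> that starts with exactly five blocks \<open>p\<close>, continues with pairs \<open>q p\<close> or \<open>p q\<close>
  (these spell the index \<open>d\<close>), and ends with the blocks \<open>p\<close>, \<open>q\<close>.  The cut omits \<open>lpad\<close>, the first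
  \<open>s\<close> letters, and \<open>rpad\<close>, everything after the letter \<open>b\<close> of the last block.

  Assume that a proper suffix of one code word is a prefix of another.  If the overlap is long, it
  contains the whole initial part of the second word that follows the period \<open>length p\<close>.  The first
  word then has this period on a stretch of almost five blocks, away from its own beginning.  The
  letter at offset \<open>length c\<close> tells \<open>p\<close> from \<open>q\<close>, so all neighbouring blocks in the stretch
  would be equal; but the stretch contains the junction after the leading blocks \<open>p\<close> or a full pair.

  If the overlap is short, the suffix lies in the periodic part of the second word.  Its last letter
  \<open>b\<close> stands where the period of the preceding block \<open>p\<close> predicts \<open>a\<close>, so it has at most
  \<open>length p\<close> letters.  It is then the beginning of the rotation of \<open>p\<close> by \<open>s\<close>, and it differs only in
  the last letter, \<open>b\<close> instead of \<open>a\<close>, from a piece of the periodic repetition of \<open>p\<close>.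
  This cannot happen if \<open>s\<close> gives the least rotation for an order in which \<open>b\<close> is the largest
  letter.\<close>
lemma nonoverlapping_code:
  fixes p q :: "'s list" and D :: "'d set"
  assumes len: "length p = length q" and neq: "p \<noteq> q" and D: "finite D"
  obtains lpad pre suf rpad mid code n
  where "lpad @ pre = p" "suf @ rpad = q"
    "\<And>d. mid d \<noteq> []" "\<And>d. set (mid d) \<subseteq> {p, q}"
    "\<And>d. code d = pre @ concat (mid d) @ suf"
    "\<And>d. length (code d) = n" "0 < n" "inj_on code D"
    "\<And>d d' k. \<lbrakk>d \<in> D; d' \<in> D; 0 < k; k < n\<rbrakk> \<Longrightarrow> \<exists>i<n - k. code d ! (k + i) \<noteq> code d' ! i"
proof -
  obtain c a b p' q' where p: "p = c @ a # p'" and q: "q = c @ b # q'" and ab: "a \<noteq> b"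
    using same_length_different[OF neq len] by auto
  define l lc where "l = length p" and "lc = length c"
  have lq: "length q = l" and lc: "lc < l" using len p by (auto simp: l_def lc_def)
  have plc: "p ! lc = a" and qlc: "q ! lc = b" by (auto simp: p q lc_def)
  have pq_c: "q ! i = p ! i" if "i < lc" for i
    using that by (simp add: p q lc_def nth_append)
  obtain s where s: "s < l" and rot0: "\<And>x t. \<lbrakk>t < l; \<And>i. i < t \<Longrightarrow> p ! ((s + i) mod l) = p ! ((x + i) mod l)\<rbrakk>
      \<Longrightarrow> (if p ! ((s + t) mod l) = b then 1 else 0) \<le> (if p ! ((x + t) mod l) = b then 1 else (0::nat))"
    using minimal_rotation[of p "\<lambda>y. if y = b then 1 else 0"] p unfolding l_def by blast
  \<comment> \<open>With the rank of \<open>b\<close> above all others, minimality says that \<open>b\<close> can only be matched by \<open>b\<close>.\<close>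
  have rot: "p ! ((x + t) mod l) = b"
    if "t < l" "\<And>i. i < t \<Longrightarrow> p ! ((s + i) mod l) = p ! ((x + i) mod l)" "p ! ((s + t) mod l) = b" for x t
    using rot0[of t x] that by (auto split: if_splits)
  obtain h where h: "bij_betw h D {0..<card D}"
    using ex_bij_betw_finite_nat[OF D] by blast
  \<comment> \<open>\<open>J\<close> is the number of the last block, and \<open>B d j\<close> says that block \<open>j\<close> is \<open>q\<close>.  After the five
    blocks \<open>p\<close>, the pairs number \<open>0\<close> and \<open>h d + 1\<close> are \<open>q p\<close>, all others \<open>p q\<close>; there are \<open>card D + 2\<close>
    pairs, so that the last one is always \<open>p q\<close>.\<close>
  define J where "J = 2 * card D + 8"
  define B where "B = (\<lambda>d j. 5 \<le> j \<and> (((j - 5) div 2 = 0 \<or> (j - 5) div 2 = Suc (h d)) \<longleftrightarrow> even (j - 5)))"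
  have hD: "h d < card D" if "d \<in> D" for d using h that by (auto simp: bij_betw_def)
  have B_low: "\<not> B d j" if "j < 5" for d j using that by (simp add: B_def)
  have B5: "B d 5" for d by (simp add: B_def)
  have B_pair: "B d j \<noteq> B d (Suc j)" if j: "5 \<le> j" "even (j - 5)" for d j
  proof -
    obtain k where "j = 5 + 2 * k" using j by (metis evenE le_add_diff_inverse)
    then show ?thesis by (simp add: B_def)
  qed
  have B_last: "B d J" "\<not> B d (J - 1)" if "d \<in> D" for d
    using hD[OF that] by (auto simp: B_def J_def)
  define blk where "blk = (\<lambda>d j. if B d j then q else p)"
  have blk: "length (blk d j) = l" for d j using lq by (simp add: blk_def l_def)
  define Y where "Y = (\<lambda>d j. blk d (j div l) ! (j mod l))"
  have Y_lc: "Y d (j * l + lc) = (if B d j then b else a)" for d j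
    using lc plc qlc by (simp add: Y_def blk_def)
  have Y_p: "Y d j = p ! (j mod l)" if "\<not> B d (j div l) \<or> j mod l < lc" for d j
    using that pq_c by (auto simp: Y_def blk_def)
  have Y_start: "Y d j = p ! (j mod l)" if "j < 5 * l + lc" for d j
  proof (cases "j < 5 * l")
    case True
    then have "j div l < 5" using s by (simp add: less_mult_imp_div_less)
    then show ?thesis using B_low Y_p by blast
  next
    case False
    then have "j div l = 5" using that lc by (intro div_nat_eqI) auto
    then have "j mod l = j - 5 * l" by (simp add: modulo_nat_def)
    then have "j mod l < lc" using that False by linarith
    then show ?thesis using Y_p by blast
  qed
  define n where "n = J * l + lc + 1 - s"
  have Jl: "J * l = l + (J - 1) * l" by (simp add: J_def algebra_simps)
  have n: "n + s = J * l + lc + 1" unfolding n_def using s Jl by linarith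
  define lpad pre suf rpad where "lpad = take s p" and "pre = drop s p"
    and "suf = c @ [b]" and "rpad = q'"
  define mid where "mid = (\<lambda>d. map (blk d) [1..<J])"
  define code where "code = (\<lambda>d. pre @ concat (mid d) @ suf)"
  have len_mid: "length (concat (mid d)) = (J - 1) * l" for d
  proof -
    have "length (concat (map (blk d) [1..<k])) = (k - 1) * l" for k
    proof (induction k)
      case (Suc k)
      then show ?case using blk by (cases k) auto
    qed simp
    then show ?thesis by (simp add: mid_def)
  qed
  have len_code: "length (code d) = n" for d
    using s len_mid Jl by (simp add: code_def pre_def suf_def n_def lc_def[symmetric] l_def[symmetric])
  have whole: "concat (map (blk d) [0..<Suc J]) = lpad @ code d @ rpad" if "d \<in> D" for d
  proof -
    have "0 < J" by (simp add: J_def)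
    then have "[0..<Suc J] = 0 # [1..<J] @ [J]" by (simp add: upt_conv_Cons)
    then have "concat (map (blk d) [0..<Suc J]) = blk d 0 @ concat (mid d) @ blk d J"
      by (simp add: mid_def)
    also have "blk d 0 = lpad @ pre" using B_low[of 0 d] by (simp add: blk_def lpad_def pre_def)
    also have "blk d J = suf @ rpad" using B_last[OF that] by (simp add: blk_def suf_def rpad_def q)
    finally show ?thesis by (simp add: code_def)
  qed
  have code_nth: "code d ! i = Y d (s + i)" if "d \<in> D" "i < n" for d i
  proof -
    have "code d ! i = (lpad @ code d @ rpad) ! (s + i)"
      using that s len_code by (simp add: nth_append lpad_def l_def)
    also have "\<dots> = blk d ((s + i) div l) ! ((s + i) mod l)"
      unfolding whole[OF that(1), symmetric]
      using that n lc blk by (intro concat_map_uniform) auto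
    finally show ?thesis by (simp add: Y_def)
  qed
  have inj: "inj_on code D"
  proof (rule inj_onI, rule ccontr)
    fix d d' assume d: "d \<in> D" "d' \<in> D" and eq: "code d = code d'" and "d \<noteq> d'"
    then have hh: "h d \<noteq> h d'" using h by (auto simp: bij_betw_def dest: inj_onD)
    define j where "j = 2 * h d + 7"
    have j: "B d j" "\<not> B d' j" using hh by (auto simp: B_def j_def)
    have "j \<le> J" using hD[OF d(1)] by (simp add: j_def J_def)
    then have "j * l \<le> J * l" by (rule mult_right_mono) simp
    then have "j * l + lc < n + s" using n by linarith
    moreover have "1 * l \<le> j * l" by (rule mult_right_mono) (simp_all add: j_def)
    then have "s \<le> j * l + lc" using s by linarith
    ultimately have "Y d (j * l + lc) = Y d' (j * l + lc)"
      using code_nth[OF d(1), of "j * l + lc - s"] code_nth[OF d(2), of "j * l + lc - s"] eq by simp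
    then show False using Y_lc j ab by simp
  qed
  have nonoverlap: "\<exists>i<n - k. code d ! (k + i) \<noteq> code d' ! i"
    if d: "d \<in> D" "d' \<in> D" and k: "0 < k" "k < n" for d d' k
  proof (rule ccontr)
    assume "\<not> ?thesis"
    then have eq: "Y d (s + k + i) = Y d' (s + i)" if "i < n - k" for i
      using code_nth[OF d(1), of "k + i"] code_nth[OF d(2), of i] that k by (simp add: add.assoc)
    show False
    proof (cases "n - k + s > 5 * l + lc")
      case long: True
      have "Y d (x + l) = Y d x" if x: "s + k \<le> x" "x + l < k + 5 * l + lc" for x
      proof -
        define i where "i = x - (s + k)"
        have x: "x = s + k + i" "s + i + l < 5 * l + lc" using x by (auto simp: i_def)
        have "Y d (s + k + (i + l)) = Y d' (s + (i + l))" "Y d (s + k + i) = Y d' (s + i)"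
          using x long by (intro eq; linarith)+
        moreover have "Y d' (s + (i + l)) = Y d' (s + i)"
          using x Y_start[of "s + (i + l)" d'] Y_start[of "s + i" d'] by (simp add: add.assoc[symmetric])
        ultimately show ?thesis using x by (simp add: add.assoc)
      qed
      from this[of "j * l + lc" for j]
      have const: "B d (Suc j) = B d j" if "s + k \<le> j * l + lc" "Suc j * l < k + 5 * l" for j
        using that Y_lc[of d j] Y_lc[of d "Suc j"] ab by (force simp: algebra_simps split: if_splits)
      \<comment> \<open>It remains to find two different neighbouring blocks in the stretch: either number \<open>4\<close> and
        \<open>5\<close>, or the two blocks of a pair.\<close>
      define A where "A = k div l"
      have A: "A * l \<le> k" "k < Suc A * l"
        using s by (simp_all add: A_def dividend_less_div_times)
      show False
      proof (cases "A \<le> 2")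
        case True
        then have "Suc A * l \<le> 3 * l" by (intro mult_right_mono) auto
        then have "s + k \<le> 4 * l + lc" using A s by linarith
        then have "B d 5 = B d 4" using const[of 4] k by (simp add: numeral_eq_Suc)
        then show False using B5 B_low by simp
      next
        case False
        define j where "j = (if even (A + 2 - 5) then A + 2 else A + 3)"
        have j: "5 \<le> j" "even (j - 5)" "A + 2 \<le> j" "j \<le> A + 3"
          using False by (auto simp: j_def)
        have "(A + 2) * l \<le> j * l" "Suc j * l \<le> (A + 4) * l" using j by (intro mult_right_mono; simp)+
        moreover have "(A + 2) * l = Suc A * l + l" "(A + 4) * l + l = A * l + 5 * l"
          by (simp_all add: algebra_simps)
        ultimately have "s + k \<le> j * l + lc" "Suc j * l < k + 5 * l" using A s by linarith+
        then show False using const B_pair[OF j(1,2)] by blast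
      qed
    next
      case short: False
      define t where "t = n - k"
      have t: "0 < t" "t + k = n" using k by (auto simp: t_def)
      have st: "s + t \<le> 5 * l + lc" using short by (simp add: t_def)
      have end_pos: "s + k + (t - 1) = J * l + lc" using t n by linarith
      have Yb: "p ! ((s + (t - 1)) mod l) = b"
        using eq[of "t - 1"] t Y_lc[of d J] B_last(1)[OF d(1)] Y_start[of "s + (t - 1)" d'] st end_pos
        by (simp add: t_def)
      show False
      proof (cases "t > l")
        case True
        have "s + k + (t - 1 - l) = (J - 1) * l + lc" using end_pos True Jl by linarith
        then have "a = Y d' (s + (t - 1 - l))"
          using eq[of "t - 1 - l"] t(1) Y_lc[of d "J - 1"] B_last(2)[OF d(1)] by (simp add: t_def)
        also have "\<dots> = p ! ((s + (t - 1 - l)) mod l)" using st t by (intro Y_start) linarith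
        also have "(s + (t - 1 - l)) mod l = (s + (t - 1)) mod l"
        proof -
          have "s + (t - 1) = s + (t - 1 - l) + l" using True by linarith
          then show ?thesis by (metis mod_add_self2)
        qed
        finally show False using Yb ab by simp
      next
        case False
        have "p ! ((s + i) mod l) = p ! ((s + k + i) mod l)" if i: "i < t - 1" for i
        proof -
          let ?y = "s + k + i"
          have y: "(J - 1) * l \<le> ?y" "?y < J * l + lc" using end_pos i False Jl by linarith+
          have "\<not> B d (?y div l) \<or> ?y mod l < lc"
          proof (cases "?y < J * l")
            case True
            moreover have "Suc (J - 1) = J" by (simp add: J_def)
            ultimately have "?y div l = J - 1"
              using y(1) by (intro div_nat_eqI) (simp_all only: mult.commute[of l])
            then show ?thesis using B_last(2)[OF d(1)] by simp
          next
            case False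
            then have "?y div l = J" using y(2) lc by (intro div_nat_eqI) (auto simp: mult.commute)
            then have "?y mod l = ?y - J * l" by (simp add: modulo_nat_def)
            then show ?thesis using y(2) False by linarith
          qed
          then have "p ! (?y mod l) = Y d ?y" using Y_p by simp
          also have "\<dots> = Y d' (s + i)" using i by (intro eq) (simp add: t_def)
          also have "\<dots> = p ! ((s + i) mod l)" using i st by (intro Y_start) linarith
          finally show ?thesis by simp
        qed
        then have "p ! ((s + k + (t - 1)) mod l) = b"
          using rot[of "t - 1" "s + k"] False t Yb by simp
        then show False using end_pos plc lc ab by simp
      qed
    qed
  qed
  show thesis
  proof (rule that[of lpad pre suf rpad mid code n])
    show "lpad @ pre = p" by (simp add: lpad_def pre_def)
    show "suf @ rpad = q" by (simp add: suf_def rpad_def q)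
    show "mid d \<noteq> []" for d by (simp add: mid_def J_def)
    show "set (mid d) \<subseteq> {p, q}" for d by (auto simp: mid_def blk_def)
    show "0 < n" using n s Jl by linarith
  qed (use len_code inj nonoverlap in \<open>simp_all add: code_def\<close>)
qed

section \<open>Conveyor belts\<close>

lemma cellular_automaton_translate:
  assumes X: "subshift S X" and f: "f \<in> cellular_automata S X" and x: "x \<in> X"
  shows "f (\<lambda>j. x (j + k)) = (\<lambda>j. f x (j + k))"
proof (induction k rule: int_induct[where k = 0])
  case base
  then show ?case by simp
next
  case (step1 k)
  have "f (shift (\<lambda>j. x (j + k))) = shift (f (\<lambda>j. x (j + k)))"
    using f subshift_translate[OF X x] by (auto simp: cellular_automata_def)
  then show ?case using step1 by (simp add: shift_def algebra_simps)
next
  case (step2 k)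
  have "f (shift (\<lambda>j. x (j + (k - 1)))) = shift (f (\<lambda>j. x (j + (k - 1))))"
    using f subshift_translate[OF X x, of "k - 1"] by (auto simp: cellular_automata_def)
  moreover have "shift (\<lambda>j. x (j + (k - 1))) = (\<lambda>j. x (j + k))" by (simp add: shift_def)
  ultimately have "shift (f (\<lambda>j. x (j + (k - 1)))) = (\<lambda>j. f x (j + k))" using step2 by simp
  then have "f (\<lambda>j. x (j + (k - 1))) (i + 1) = f x (i + k)" for i
    unfolding shift_def by (rule fun_cong)
  from this[of "i - 1" for i] show ?case by (intro ext) (simp add: algebra_simps)
qed

text \<open>The last assumption provides, for the constant data \<open>d\<close>, a point with a run of occurrences
  that is infinite in both directions.\<close>
locale belt_code =
  fixes S :: "'s set" and X :: "(int \<Rightarrow> 's) set" and A :: "'a set"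
    and code :: "'a \<times> 'a \<Rightarrow> 's list" and n :: nat and N :: int
  assumes X: "subshift S X"
    and n_pos: "0 < n" and N_pos: "0 < N"
    and length_code: "d \<in> A \<times> A \<Longrightarrow> length (code d) = n"
    and inj_code: "inj_on code (A \<times> A)"
    and code_equiv: "d \<in> A \<times> A \<Longrightarrow> d' \<in> A \<times> A \<Longrightarrow> (code d, code d') \<in> syntactic_rel S X"
    and code_nonoverlap: "\<lbrakk>d \<in> A \<times> A; d' \<in> A \<times> A; 0 < k; k < n\<rbrakk> \<Longrightarrow>
          \<exists>i<n - k. code d ! (k + i) \<noteq> code d' ! i"
    and code_periodic: "d \<in> A \<times> A \<Longrightarrow> \<exists>x\<in>X. \<forall>k. segment x (k * N) n = code d"
begin

definition reads :: "(int \<Rightarrow> 's) \<Rightarrow> int \<Rightarrow> 'a \<times> 'a \<Rightarrow> bool" where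
  "reads x i d \<longleftrightarrow> d \<in> A \<times> A \<and> segment x i n = code d"

definition occ :: "(int \<Rightarrow> 's) \<Rightarrow> int set" where
  "occ x = {i. \<exists>d. reads x i d}"

definition datum :: "(int \<Rightarrow> 's) \<Rightarrow> int \<Rightarrow> 'a \<times> 'a" where
  "datum x i = (THE d. reads x i d)"

lemma reads_unique: "reads x i d \<Longrightarrow> reads x i d' \<Longrightarrow> d = d'"
  using inj_code by (auto simp: reads_def dest: inj_onD)

lemma datum_eqI: "reads x i d \<Longrightarrow> datum x i = d"
  unfolding datum_def using reads_unique by blast

lemma reads_datum: "i \<in> occ x \<Longrightarrow> reads x i (datum x i)"
  unfolding occ_def using datum_eqI by auto

lemma datum_in: "i \<in> occ x \<Longrightarrow> datum x i \<in> A \<times> A"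
  using reads_datum by (auto simp: reads_def)

definition separated :: "int set \<Rightarrow> bool" where
  "separated P \<longleftrightarrow> (\<forall>i\<in>P. \<forall>i'\<in>P. i < i' \<longrightarrow> i + int n \<le> i')"

lemma separated_occ: "separated (occ x)"
  unfolding separated_def
proof (intro ballI impI, rule ccontr)
  fix i i' assume i: "i \<in> occ x" "i' \<in> occ x" "i < i'" and "\<not> i + int n \<le> i'"
  then have k: "0 < nat (i' - i)" "nat (i' - i) < n" by auto
  obtain d d' where d: "d \<in> A \<times> A" "segment x i n = code d" "d' \<in> A \<times> A" "segment x i' n = code d'"
    using i by (auto simp: occ_def reads_def)
  obtain j where j: "j < n - nat (i' - i)" "code d ! (nat (i' - i) + j) \<noteq> code d' ! j"
    using code_nonoverlap[OF d(1,3) k] by blast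
  have "code d ! (nat (i' - i) + j) = x (i + int (nat (i' - i) + j))"
    using j d(2) by (metis less_diff_conv add.commute nth_segment)
  also have "\<dots> = x (i' + int j)" using i(3) by simp
  also have "\<dots> = code d' ! j" using j d(4) by (metis less_diff_conv add_lessD1 nth_segment)
  finally show False using j(2) by simp
qed

text \<open>The set \<open>P\<close> of positions to be rewritten is kept apart from the occurrences in \<open>x\<close>, so that finitely
  many of them can be rewritten one after the other.\<close>
definition overwrite :: "int set \<Rightarrow> (int \<Rightarrow> 'a \<times> 'a) \<Rightarrow> (int \<Rightarrow> 's) \<Rightarrow> int \<Rightarrow> 's" where
  "overwrite P D x j = (if \<exists>i\<in>P. i \<le> j \<and> j < i + int n
     then let i = THE i. i \<in> P \<and> i \<le> j \<and> j < i + int n in code (D i) ! nat (j - i) else x j)"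

lemma overwrite_inside:
  assumes "separated P" "i \<in> P" "i \<le> j" "j < i + int n"
  shows "overwrite P D x j = code (D i) ! nat (j - i)"
proof -
  have "(THE i. i \<in> P \<and> i \<le> j \<and> j < i + int n) = i"
  proof (rule the_equality)
    fix i' assume i': "i' \<in> P \<and> i' \<le> j \<and> j < i' + int n"
    have "\<not> i < i'" "\<not> i' < i" using assms i' unfolding separated_def by fastforce+
    then show "i' = i" by simp
  qed (use assms in auto)
  then show ?thesis using assms by (auto simp: overwrite_def)
qed

lemma overwrite_outside:
  "(\<And>i. i \<in> P \<Longrightarrow> i \<le> j \<Longrightarrow> \<not> j < i + int n) \<Longrightarrow> overwrite P D x j = x j"
  by (auto simp: overwrite_def)

lemma segment_overwrite:
  assumes "separated P" "i \<in> P" "D i \<in> A \<times> A"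
  shows "segment (overwrite P D x) i n = code (D i)"
  using assms length_code by (intro nth_equalityI) (auto simp: overwrite_inside)

lemma segment_overwrite_disjoint:
  assumes "\<And>i'. i' \<in> P \<Longrightarrow> i + int n \<le> i' \<or> i' + int n \<le> i"
  shows "segment (overwrite P D x) i n = segment x i n"
  using assms by (intro nth_equalityI) (fastforce intro!: overwrite_outside)+

lemma overwrite_finite:
  assumes "finite P" "P \<subseteq> occ x" "\<And>i. i \<in> P \<Longrightarrow> D i \<in> A \<times> A" "x \<in> X"
  shows "overwrite P D x \<in> X"
  using assms
proof (induction P rule: finite_induct)
  case empty
  then show ?case by (simp add: overwrite_def)
next
  case (insert i P)
  have sep: "separated (insert i P)" "separated P"
    using insert.prems(1) separated_occ[of x] unfolding separated_def by blast+
  have disj: "i + int n \<le> i' \<or> i' + int n \<le> i" if "i' \<in> P" for i'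
    using sep(1) that insert.hyps(2) unfolding separated_def by (metis insertCI linorder_neqE_linordered_idom)
  have ri: "reads x i (datum x i)" using insert.prems reads_datum by blast
  let ?y = "overwrite P D x"
  have y: "?y \<in> X" using insert by blast
  have w: "segment ?y i (length (code (datum x i))) = code (datum x i)"
    using segment_overwrite_disjoint[OF disj] ri length_code by (simp add: reads_def)
  have Di: "D i \<in> A \<times> A" "datum x i \<in> A \<times> A" using insert.prems ri by (auto simp: reads_def)
  have "overwrite (insert i P) D x j =
    (if i \<le> j \<and> j < i + int (length (code (datum x i))) then code (D i) ! nat (j - i) else ?y j)" for j
  proof (cases "i \<le> j \<and> j < i + int n")
    case True
    then show ?thesis using overwrite_inside[OF sep(1)] length_code Di by simp
  next
    case F: False
    show ?thesis
    proof (cases "\<exists>i'\<in>P. i' \<le> j \<and> j < i' + int n")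
      case True
      then obtain i' where "i' \<in> P" "i' \<le> j" "j < i' + int n" by blast
      then show ?thesis
        using overwrite_inside[OF sep(1), of i' j] overwrite_inside[OF sep(2), of i' j] F length_code Di
        by auto
    next
      case False
      then show ?thesis using F length_code Di by (auto simp: overwrite_def)
    qed
  qed
  then have "overwrite (insert i P) D x = (\<lambda>j. if i \<le> j \<and> j < i + int (length (code (datum x i)))
      then code (D i) ! nat (j - i) else ?y j)" by blast
  then show ?case
    using subshift_replace[OF X y code_equiv[OF Di(2,1)] _ w] length_code Di by simp
qed

abbreviation put :: "(int \<Rightarrow> 's) \<Rightarrow> (int \<Rightarrow> 'a \<times> 'a) \<Rightarrow> int \<Rightarrow> 's" where
  "put x D \<equiv> overwrite (occ x) D x"

text \<open>Infinitely many replacements are a limit of finitely many.\<close>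
lemma put_in:
  assumes x: "x \<in> X" and D: "\<And>i. i \<in> occ x \<Longrightarrow> D i \<in> A \<times> A"
  shows "put x D \<in> X"
proof -
  have lim: "\<exists>z\<in>X. agree m (put x D) z" for m
  proof
    define P where "P = occ x \<inter> {- \<bar>m\<bar> - int n..\<bar>m\<bar>}"
    have P: "finite P" "P \<subseteq> occ x" by (auto simp: P_def)
    show "overwrite P D x \<in> X" using overwrite_finite[OF P _ x] D P(2) by blast
    have sepP: "separated P" using separated_occ[of x] P(2) unfolding separated_def by blast
    have "put x D j = overwrite P D x j" if "\<bar>j\<bar> \<le> m" for j
    proof (cases "\<exists>i\<in>occ x. i \<le> j \<and> j < i + int n")
      case True
      then obtain i where i: "i \<in> occ x" "i \<le> j" "j < i + int n" by blast
      then have "i \<in> P" using that by (auto simp: P_def)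
      then show ?thesis
        using overwrite_inside[OF separated_occ i] overwrite_inside[OF sepP _ i(2,3)] by simp
    next
      case False
      then show ?thesis by (auto simp: overwrite_def P_def)
    qed
    then show "agree m (put x D) (overwrite P D x)" by (simp add: agree_def)
  qed
  moreover have "put x D \<in> full_shift S"
    unfolding in_full_shift_iff
  proof
    fix j
    obtain z where "z \<in> X" "agree \<bar>j\<bar> (put x D) z" using lim by blast
    then show "put x D j \<in> S"
      using subshift_subset[OF X] by (auto simp: agree_def in_full_shift_iff)
  qed
  ultimately show ?thesis using subshift_limit[OF X] by blast
qed

lemma reads_put:
  assumes "i \<in> occ x" "D i \<in> A \<times> A"
  shows "reads (put x D) i (D i)"
  using segment_overwrite[OF separated_occ] assms by (simp add: reads_def)

text \<open>All old occurrences are still occurrences, of other code words.  A new occurrence cannot overlap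
  any of them, so it lies in the untouched part and was there before.\<close>
lemma occ_put:
  assumes D: "\<And>i. i \<in> occ x \<Longrightarrow> D i \<in> A \<times> A"
  shows "occ (put x D) = occ x"
proof
  show sub: "occ x \<subseteq> occ (put x D)" using reads_put D unfolding occ_def by blast
  show "occ (put x D) \<subseteq> occ x"
  proof
    fix i assume i: "i \<in> occ (put x D)"
    show "i \<in> occ x"
    proof (rule ccontr)
      assume "i \<notin> occ x"
      have "i + int n \<le> i' \<or> i' + int n \<le> i" if "i' \<in> occ x" for i'
      proof -
        have "i' \<in> occ (put x D)" "i \<noteq> i'" using that sub \<open>i \<notin> occ x\<close> by auto
        then show ?thesis using separated_occ[of "put x D"] i unfolding separated_def
          by (metis linorder_neqE_linordered_idom)
      qed
      then have "segment (put x D) i n = segment x i n" by (rule segment_overwrite_disjoint)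
      then show False using i \<open>i \<notin> occ x\<close> by (auto simp: occ_def reads_def)
    qed
  qed
qed

lemma datum_put: "i \<in> occ x \<Longrightarrow> D i \<in> A \<times> A \<Longrightarrow> datum (put x D) i = D i"
  by (intro datum_eqI reads_put)

lemma put_cong:
  assumes "\<And>i. i \<in> occ x \<Longrightarrow> D i = D' i"
  shows "put x D = put x D'"
proof
  fix j
  show "put x D j = put x D' j"
  proof (cases "\<exists>i\<in>occ x. i \<le> j \<and> j < i + int n")
    case True
    then show ?thesis using overwrite_inside[OF separated_occ] assms by metis
  qed (auto simp: overwrite_def)
qed

lemma put_put:
  assumes "\<And>i. i \<in> occ x \<Longrightarrow> D i \<in> A \<times> A"
  shows "put (put x D) D' = put x D'"
proof
  fix j
  have "overwrite (occ x) D' (put x D) j = put x D' j"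
  proof (cases "\<exists>i\<in>occ x. i \<le> j \<and> j < i + int n")
    case True
    then show ?thesis using overwrite_inside[OF separated_occ] by metis
  next
    case False
    then show ?thesis by (auto simp: overwrite_def)
  qed
  then show "put (put x D) D' j = put x D' j" by (simp only: occ_put[OF assms])
qed

lemma put_datum: "put x (datum x) = x"
proof
  fix j
  show "put x (datum x) j = x j"
  proof (cases "\<exists>i\<in>occ x. i \<le> j \<and> j < i + int n")
    case True
    then obtain i where i: "i \<in> occ x" "i \<le> j" "j < i + int n" by blast
    have "put x (datum x) j = code (datum x i) ! nat (j - i)"
      by (rule overwrite_inside[OF separated_occ i])
    also have "code (datum x i) = segment x i n" using reads_datum[OF i(1)] by (simp add: reads_def)
    also have "segment x i n ! nat (j - i) = x j" using i by simp
    finally show ?thesis .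
  qed (auto simp: overwrite_def)
qed

text \<open>A node is an occurrence together with one of its two tracks; on the track \<open>True\<close> one moves to the
  right, on the track \<open>False\<close> to the left, and without a neighbour in that direction one changes the
  track.  A position outside \<open>P\<close> counts as a run of its own, which makes \<open>succ_node P\<close> a bijection of
  all nodes with inverse \<open>pred_node P\<close>.\<close>
definition succ_node :: "int set \<Rightarrow> int \<times> bool \<Rightarrow> int \<times> bool" where
  "succ_node P = (\<lambda>(i, t). let i' = (if t then i + N else i - N)
     in if i \<in> P \<and> i' \<in> P then (i', t) else (i, \<not> t))"

definition pred_node :: "int set \<Rightarrow> int \<times> bool \<Rightarrow> int \<times> bool" where
  "pred_node P = (\<lambda>(i, t). let i' = (if t then i - N else i + N)
     in if i \<in> P \<and> i' \<in> P then (i', t) else (i, \<not> t))"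

lemma pred_succ_node [simp]: "pred_node P (succ_node P v) = v"
  by (cases v) (auto simp: pred_node_def succ_node_def Let_def)

lemma succ_pred_node [simp]: "succ_node P (pred_node P v) = v"
  by (cases v) (auto simp: pred_node_def succ_node_def Let_def)

definition walk :: "int set \<Rightarrow> int \<Rightarrow> int \<times> bool \<Rightarrow> int \<times> bool" where
  "walk P k v = (if 0 \<le> k then (succ_node P ^^ nat k) v else (pred_node P ^^ nat (- k)) v)"

lemma walk_0 [simp]: "walk P 0 v = v"
  by (simp add: walk_def)

lemma walk_succ: "walk P (k + 1) v = succ_node P (walk P k v)"
proof (cases "0 \<le> k")
  case True
  then show ?thesis by (simp add: walk_def nat_add_distrib)
next
  case False
  define m where "m = nat (- k - 1)"
  have "nat (- k) = Suc m" "nat (- (k + 1)) = m" using False by (auto simp: m_def)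
  then have "walk P k v = pred_node P ((pred_node P ^^ m) v)" "walk P (k + 1) v = (pred_node P ^^ m) v"
    using False by (auto simp: walk_def)
  then show ?thesis by simp
qed

lemma walk_pred: "walk P (k - 1) v = pred_node P (walk P k v)"
  using walk_succ[of P "k - 1" v] by simp

lemma walk_walk: "walk P j (walk P k v) = walk P (j + k) v"
proof (induction j rule: int_induct[where k = 0])
  case (step1 j)
  have "j + 1 + k = j + k + 1" by simp
  then show ?case using step1 by (simp only: walk_succ)
next
  case (step2 j)
  have "j - 1 + k = j + k - 1" by simp
  then show ?case using step2 by (simp only: walk_pred)
qed simp

lemma walk_mem:
  assumes "fst v \<in> P"
  shows "fst (walk P k v) \<in> P"
proof (induction k rule: int_induct[where k = 0])
  case (step1 k)
  then show ?case by (auto simp: walk_succ succ_node_def Let_def split: prod.split)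
next
  case (step2 k)
  then show ?case by (auto simp: walk_pred pred_node_def Let_def split: prod.split)
qed (use assms in simp)

definition track :: "bool \<Rightarrow> 'a \<times> 'a \<Rightarrow> 'a" where
  "track t d = (if t then fst d else snd d)"

definition belt :: "(int \<Rightarrow> 's) \<Rightarrow> int \<times> bool \<Rightarrow> int \<Rightarrow> 'a" where
  "belt x v k = track (snd (walk (occ x) k v)) (datum x (fst (walk (occ x) k v)))"

lemma belt_in: "fst v \<in> occ x \<Longrightarrow> belt x v \<in> full_shift A"
  using datum_in[OF walk_mem] by (auto simp: in_full_shift_iff belt_def track_def mem_Times_iff)

lemma belt_walk: "belt x (walk (occ x) k v) = (\<lambda>j. belt x v (j + k))"
  by (rule ext) (simp add: belt_def walk_walk)

definition new_datum :: "((int \<Rightarrow> 'a) \<Rightarrow> int \<Rightarrow> 'a) \<Rightarrow> (int \<Rightarrow> 's) \<Rightarrow> int \<Rightarrow> 'a \<times> 'a" where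
  "new_datum f x i = (f (belt x (i, True)) 0, f (belt x (i, False)) 0)"

definition act :: "((int \<Rightarrow> 'a) \<Rightarrow> int \<Rightarrow> 'a) \<Rightarrow> (int \<Rightarrow> 's) \<Rightarrow> int \<Rightarrow> 's" where
  "act f x = put x (new_datum f x)"

lemma automaton_maps:
  "f \<in> cellular_automata A (full_shift A) \<Longrightarrow> c \<in> full_shift A \<Longrightarrow> f c \<in> full_shift A"
  by (auto simp: cellular_automata_def)

lemma new_datum_in:
  assumes "f \<in> cellular_automata A (full_shift A)" "i \<in> occ x"
  shows "new_datum f x i \<in> A \<times> A"
  using automaton_maps[OF assms(1) belt_in] assms(2) by (auto simp: new_datum_def in_full_shift_iff)

lemma act_in: "f \<in> cellular_automata A (full_shift A) \<Longrightarrow> x \<in> X \<Longrightarrow> act f x \<in> X"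
  unfolding act_def by (intro put_in new_datum_in)

lemma occ_act: "f \<in> cellular_automata A (full_shift A) \<Longrightarrow> occ (act f x) = occ x"
  unfolding act_def by (intro occ_put new_datum_in)

text \<open>The heart of the construction.  Seen from the node reached after \<open>k\<close> steps the belt is the
  translate by \<open>k\<close>, so writing the value of \<open>f\<close> at \<open>0\<close> into each node writes the whole
  configuration \<open>f (belt x v)\<close> onto the belt, because \<open>f\<close> commutes with the shift.\<close>
lemma belt_act:
  assumes f: "f \<in> cellular_automata A (full_shift A)" and v: "fst v \<in> occ x"
  shows "belt (act f x) v = f (belt x v)"
proof
  fix k
  define w where "w = walk (occ x) k v"
  have w: "fst w \<in> occ x" unfolding w_def by (rule walk_mem[OF v])
  have "belt (act f x) v k = track (snd w) (datum (act f x) (fst w))"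
    by (simp add: belt_def occ_act[OF f] w_def)
  also have "\<dots> = track (snd w) (new_datum f x (fst w))"
    unfolding act_def using datum_put[of _ _ "new_datum f x", OF w new_datum_in[OF f w]] by simp
  also have "\<dots> = f (belt x w) 0" by (cases w) (simp add: track_def new_datum_def)
  also have "\<dots> = f (\<lambda>j. belt x v (j + k)) 0" unfolding w_def belt_walk ..
  also have "\<dots> = f (belt x v) (0 + k)"
    unfolding cellular_automaton_translate[OF subshift_full_shift f belt_in[OF v]] ..
  finally show "belt (act f x) v k = f (belt x v) k" by simp
qed

lemma act_compose:
  assumes f: "f \<in> cellular_automata A (full_shift A)" and g: "g \<in> cellular_automata A (full_shift A)"
  shows "act (compose (full_shift A) f g) x = act f (act g x)"
proof -
  have "act f (act g x) = put x (new_datum f (act g x))"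
    unfolding act_def[of f] unfolding act_def[of g] by (intro put_put new_datum_in g)
  also have "\<dots> = put x (new_datum (compose (full_shift A) f g) x)"
    by (rule put_cong) (simp add: new_datum_def belt_act[OF g] compose_def belt_in)
  finally show ?thesis by (simp add: act_def)
qed

lemma act_id: "act (\<lambda>c\<in>full_shift A. c) x = x"
proof -
  have "act (\<lambda>c\<in>full_shift A. c) x = put x (datum x)"
    unfolding act_def by (rule put_cong) (simp add: new_datum_def belt_in, simp add: belt_def track_def)
  then show ?thesis by (simp add: put_datum)
qed

lemma reads_shift: "reads (shift x) i d \<longleftrightarrow> reads x (i + 1) d"
proof -
  have "segment (shift x) i n = segment x (i + 1) n" by (simp add: segment_def shift_def algebra_simps)
  then show ?thesis by (simp add: reads_def)
qed

lemma occ_shift: "i \<in> occ (shift x) \<longleftrightarrow> i + 1 \<in> occ x"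
  by (simp add: occ_def reads_shift)

lemma datum_shift: "datum (shift x) i = datum x (i + 1)"
  by (simp add: datum_def reads_shift)

lemma walk_shift:
  "walk (occ (shift x)) k (i, t) = apfst (\<lambda>i. i - 1) (walk (occ x) k (i + 1, t))"
proof (induction k rule: int_induct[where k = 0])
  case (step1 k)
  then show ?case
    unfolding walk_succ
    by (cases "walk (occ x) k (i + 1, t)") (auto simp: succ_node_def Let_def occ_shift)
next
  case (step2 k)
  then show ?case
    unfolding walk_pred
    by (cases "walk (occ x) k (i + 1, t)") (auto simp: pred_node_def Let_def occ_shift)
qed simp

lemma belt_shift: "belt (shift x) (i, t) = belt x (i + 1, t)"
  by (rule ext) (simp add: belt_def walk_shift datum_shift)

lemma act_shift: "act f (shift x) = shift (act f x)"
proof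
  fix j
  have D: "new_datum f (shift x) i = new_datum f x (i + 1)" for i
    by (simp add: new_datum_def belt_shift)
  show "act f (shift x) j = shift (act f x) j"
  proof (cases "\<exists>i\<in>occ x. i \<le> j + 1 \<and> j + 1 < i + int n")
    case True
    then obtain i where i: "i \<in> occ x" "i \<le> j + 1" "j + 1 < i + int n" by blast
    then have i': "i - 1 \<in> occ (shift x)" "i - 1 \<le> j" "j < i - 1 + int n" by (auto simp: occ_shift)
    show ?thesis
      unfolding act_def shift_def[of "put _ _"]
        overwrite_inside[OF separated_occ i] overwrite_inside[OF separated_occ i'] D
      by (simp add: algebra_simps)
  next
    case False
    have "act f x (j + 1) = x (j + 1)"
      unfolding act_def using False by (intro overwrite_outside) blast
    moreover have "act f (shift x) j = shift x j"
      unfolding act_def using False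
      by (intro overwrite_outside) (auto simp: occ_shift dest!: bspec)
    ultimately show ?thesis by (simp add: shift_def)
  qed
qed

lemma reads_agree:
  assumes "agree m x y" "\<bar>i\<bar> + int n \<le> m"
  shows "reads x i = reads y i"
proof -
  have "segment x i n = segment y i n"
    using assms by (intro nth_equalityI) (auto simp: agree_def)
  then show ?thesis by (simp add: reads_def fun_eq_iff)
qed

lemma occ_agree: "agree m x y \<Longrightarrow> \<bar>i\<bar> + int n \<le> m \<Longrightarrow> i \<in> occ x \<longleftrightarrow> i \<in> occ y"
  using reads_agree by (simp add: occ_def)

lemma datum_agree: "agree m x y \<Longrightarrow> \<bar>i\<bar> + int n \<le> m \<Longrightarrow> datum x i = datum y i"
  using reads_agree by (simp add: datum_def)

text \<open>The next node depends only on the occurrences within distance \<open>N\<close>, so \<open>\<bar>k\<bar>\<close> steps stay in a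
  window that grows linearly in \<open>\<bar>k\<bar>\<close>.\<close>
lemma walk_agree:
  assumes xy: "agree m x y"
  shows "\<bar>i\<bar> + (\<bar>k\<bar> + 1) * N + int n \<le> m \<Longrightarrow>
    walk (occ y) k (i, t) = walk (occ x) k (i, t) \<and> \<bar>fst (walk (occ x) k (i, t))\<bar> \<le> \<bar>i\<bar> + \<bar>k\<bar> * N"
proof (induction k rule: int_induct[where k = 0])
  case (step1 k)
  obtain i' t' where w: "walk (occ x) k (i, t) = (i', t')" by fastforce
  have k: "\<bar>k + 1\<bar> = \<bar>k\<bar> + 1" using step1 by simp
  have m: "\<bar>i\<bar> + \<bar>k\<bar> * N + N + N + int n \<le> m" using step1.prems unfolding k by (simp add: algebra_simps)
  then have "\<bar>i\<bar> + (\<bar>k\<bar> + 1) * N + int n \<le> m" using N_pos by (simp add: algebra_simps)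
  then have IH: "walk (occ y) k (i, t) = (i', t')" "\<bar>i'\<bar> \<le> \<bar>i\<bar> + \<bar>k\<bar> * N" using step1.IH w by auto
  have "i' \<in> occ x \<longleftrightarrow> i' \<in> occ y" "i' + N \<in> occ x \<longleftrightarrow> i' + N \<in> occ y"
    "i' - N \<in> occ x \<longleftrightarrow> i' - N \<in> occ y"
    using IH(2) m N_pos by (intro occ_agree[OF xy]; linarith)+
  then show ?case
    using IH w N_pos unfolding k walk_succ by (auto simp: succ_node_def Let_def algebra_simps)
next
  case (step2 k)
  obtain i' t' where w: "walk (occ x) k (i, t) = (i', t')" by fastforce
  have k: "\<bar>k - 1\<bar> = \<bar>k\<bar> + 1" using step2 by simp
  have m: "\<bar>i\<bar> + \<bar>k\<bar> * N + N + N + int n \<le> m" using step2.prems unfolding k by (simp add: algebra_simps)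
  then have "\<bar>i\<bar> + (\<bar>k\<bar> + 1) * N + int n \<le> m" using N_pos by (simp add: algebra_simps)
  then have IH: "walk (occ y) k (i, t) = (i', t')" "\<bar>i'\<bar> \<le> \<bar>i\<bar> + \<bar>k\<bar> * N" using step2.IH w by auto
  have "i' \<in> occ x \<longleftrightarrow> i' \<in> occ y" "i' + N \<in> occ x \<longleftrightarrow> i' + N \<in> occ y"
    "i' - N \<in> occ x \<longleftrightarrow> i' - N \<in> occ y"
    using IH(2) m N_pos by (intro occ_agree[OF xy]; linarith)+
  then show ?case
    using IH w N_pos unfolding k walk_pred by (auto simp: pred_node_def Let_def algebra_simps)
qed simp

lemma belt_agree:
  assumes xy: "agree m x y" and m: "\<bar>i\<bar> + (\<bar>k\<bar> + 1) * N + int n \<le> m"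
  shows "belt y (i, t) k = belt x (i, t) k"
proof -
  have "\<bar>fst (walk (occ x) k (i, t))\<bar> + int n \<le> m"
    using conjunct2[OF walk_agree[OF xy m, of t]] m N_pos by (simp add: algebra_simps)
  then show ?thesis
    using walk_agree[OF xy m] datum_agree[OF xy] by (simp add: belt_def)
qed

text \<open>The value of \<open>f\<close> at \<open>0\<close> depends on finitely many letters of each of the two belts through \<open>i\<close>,
  and each of these letters on finitely many coordinates of \<open>x\<close>.\<close>
lemma new_datum_local:
  assumes f: "f \<in> cellular_automata A (full_shift A)" and i: "i \<in> occ x"
  obtains m where "\<And>y. agree m x y \<Longrightarrow> new_datum f y i = new_datum f x i"
proof -
  have fc: "\<forall>c\<in>full_shift A. \<forall>j. \<exists>r. \<forall>c'\<in>full_shift A. agree r c c' \<longrightarrow> f c' j = f c j"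
  proof -
    have "f \<in> full_shift A \<rightarrow> full_shift A" using f by (auto simp: cellular_automata_def)
    from continuous_map_iff_local[OF order.refl this] show ?thesis
      using f by (auto simp: cellular_automata_def)
  qed
  have b: "belt x (i, t) \<in> full_shift A" for t using belt_in i by simp
  have "\<forall>t. \<exists>r. \<forall>c'\<in>full_shift A. agree r (belt x (i, t)) c' \<longrightarrow> f c' 0 = f (belt x (i, t)) 0"
    using fc b by blast
  then obtain r where r: "\<And>t c'. c' \<in> full_shift A \<Longrightarrow> agree (r t) (belt x (i, t)) c' \<Longrightarrow>
      f c' 0 = f (belt x (i, t)) 0"
    by metis
  define m where "m t = \<bar>i\<bar> + (\<bar>r t\<bar> + 1) * N + int n" for t
  have loc: "f (belt y (i, t)) 0 = f (belt x (i, t)) 0" if y: "agree (m t) x y" for y t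
  proof (rule r)
    have "\<bar>i\<bar> + int n \<le> m t" using N_pos by (simp add: m_def)
    then show "belt y (i, t) \<in> full_shift A"
      using i occ_agree[OF y] by (intro belt_in) simp
    show "agree (r t) (belt x (i, t)) (belt y (i, t))"
      unfolding agree_def
    proof (intro allI impI)
      fix k assume "\<bar>k\<bar> \<le> r t"
      then have "(\<bar>k\<bar> + 1) * N \<le> (\<bar>r t\<bar> + 1) * N" using N_pos by (intro mult_right_mono) auto
      then show "belt x (i, t) k = belt y (i, t) k"
        using belt_agree[OF y, of i k] by (simp add: m_def)
    qed
  qed
  show thesis
  proof (rule that[of "max (m True) (m False)"])
    fix y assume "agree (max (m True) (m False)) x y"
    then have "agree (m t) x y" for t by (cases t) (auto simp: agree_def)
    then show "new_datum f y i = new_datum f x i" using loc by (simp add: new_datum_def)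
  qed
qed

lemma act_local:
  assumes f: "f \<in> cellular_automata A (full_shift A)"
  shows "\<exists>m. \<forall>y. agree m x y \<longrightarrow> act f y j = act f x j"
proof (cases "\<exists>i\<in>occ x. i \<le> j \<and> j < i + int n")
  case True
  then obtain i where i: "i \<in> occ x" "i \<le> j" "j < i + int n" by blast
  obtain m where m: "\<And>y. agree m x y \<Longrightarrow> new_datum f y i = new_datum f x i"
    using new_datum_local[OF f i(1)] by blast
  have "act f y j = act f x j" if y: "agree (max m (\<bar>i\<bar> + int n)) x y" for y
  proof -
    have "i \<in> occ y" using i(1) occ_agree[OF y] by simp
    moreover have "new_datum f y i = new_datum f x i" using y by (intro m) (auto simp: agree_def)
    ultimately show ?thesis
      unfolding act_def overwrite_inside[OF separated_occ i]
      using overwrite_inside[OF separated_occ _ i(2,3)] by simp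
  qed
  then show ?thesis by blast
next
  case False
  have "act f y j = act f x j" if y: "agree (\<bar>j\<bar> + 2 * int n) x y" for y
  proof -
    have "\<not> (\<exists>i\<in>occ y. i \<le> j \<and> j < i + int n)"
    proof
      assume "\<exists>i\<in>occ y. i \<le> j \<and> j < i + int n"
      then obtain i where i: "i \<in> occ y" "i \<le> j" "j < i + int n" by blast
      then have "i \<in> occ x" using occ_agree[OF y, of i] by fastforce
      then show False using False i by blast
    qed
    then have "act f y j = y j" unfolding act_def by (intro overwrite_outside) blast
    moreover have "act f x j = x j" unfolding act_def using False by (intro overwrite_outside) blast
    ultimately show ?thesis using y by (simp add: agree_def)
  qed
  then show ?thesis by blast
qed

lemma act_automaton:
  assumes f: "f \<in> cellular_automata A (full_shift A)"
  shows "restrict (act f) X \<in> cellular_automata S X"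
proof -
  have maps: "restrict (act f) X \<in> X \<rightarrow> X" using act_in[OF f] by auto
  have "\<exists>m. \<forall>y\<in>X. agree m x y \<longrightarrow> restrict (act f) X y j = restrict (act f) X x j"
    if "x \<in> X" for x j
    using act_local[OF f, of x j] that by auto
  then have "continuous_map (subtopology (full_shift_topology S) X)
      (subtopology (full_shift_topology S) X) (restrict (act f) X)"
    unfolding continuous_map_iff_local[OF subshift_subset[OF X] maps] by blast
  moreover have "restrict (act f) X (shift x) = shift (restrict (act f) X x)" if "x \<in> X" for x
  proof -
    have "shift x \<in> X" using X that by (auto simp: subshift_def)
    then show ?thesis using that by (simp add: act_shift)
  qed
  ultimately show ?thesis using act_in[OF f] by (auto simp: cellular_automata_def)
qed

text \<open>In the periodic point all occurrences at multiples of \<open>N\<close> are neighbours, so its track \<open>True\<close>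
  never turns around, and \<open>c\<close> can be written on it.\<close>
lemma belt_realised:
  assumes c: "c \<in> full_shift A"
  obtains x where "x \<in> X" "0 \<in> occ x" "belt x (0, True) = c"
proof -
  have cA: "c k \<in> A" for k using c by (simp add: in_full_shift_iff)
  obtain z where z: "z \<in> X" "\<And>k. segment z (k * N) n = code (c 0, c 0)"
    using code_periodic[of "(c 0, c 0)"] cA by auto
  have occz: "k * N \<in> occ z" for k using z(2) cA by (auto simp: occ_def reads_def)
  define D where "D = (\<lambda>i. (c (i div N), c (i div N)))"
  have D: "D i \<in> A \<times> A" for i using cA by (simp add: D_def)
  define x where "x = put z D"
  have occx: "occ x = occ z" unfolding x_def by (rule occ_put[OF D])
  have walk: "walk (occ x) k (0, True) = (k * N, True)" for k
  proof (induction k rule: int_induct[where k = 0])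
    case (step1 k)
    have "k * N \<in> occ x" "k * N + N \<in> occ x"
      using occz[of k] occz[of "k + 1"] by (auto simp: occx algebra_simps)
    then show ?case using step1 unfolding walk_succ by (simp add: succ_node_def algebra_simps)
  next
    case (step2 k)
    have "k * N \<in> occ x" "k * N - N \<in> occ x"
      using occz[of k] occz[of "k - 1"] by (auto simp: occx algebra_simps)
    then show ?case using step2 unfolding walk_pred by (simp add: pred_node_def algebra_simps)
  qed simp
  show thesis
  proof (rule that)
    show "x \<in> X" unfolding x_def using z(1) D by (rule put_in)
    show "0 \<in> occ x" using occz[of 0] by (simp add: occx)
    show "belt x (0, True) = c"
    proof
      fix k
      have "datum x (k * N) = D (k * N)" unfolding x_def using occz D by (rule datum_put)
      then show "belt x (0, True) k = c k" using N_pos by (simp add: belt_def walk track_def D_def)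
    qed
  qed
qed

lemma act_injective:
  assumes f: "f \<in> cellular_automata A (full_shift A)" and g: "g \<in> cellular_automata A (full_shift A)"
    and eq: "\<And>x. x \<in> X \<Longrightarrow> act f x = act g x"
  shows "f = g"
proof (rule extensionalityI)
  show "f \<in> extensional (full_shift A)" "g \<in> extensional (full_shift A)"
    using f g by (auto simp: cellular_automata_def PiE_def)
  fix c assume "c \<in> full_shift A"
  then obtain x where x: "x \<in> X" "0 \<in> occ x" "belt x (0, True) = c" by (rule belt_realised)
  have "f c = belt (act f x) (0, True)" using belt_act[OF f] x by simp
  also have "\<dots> = belt (act g x) (0, True)" using eq[OF x(1)] by simp
  also have "\<dots> = g c" using belt_act[OF g] x by simp
  finally show "f c = g c" .
qed

lemma End_embedding:
  "\<exists>\<phi>. \<phi> \<in> hom (End A (full_shift A)) (End S X) \<and>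
        \<phi> \<one>\<^bsub>End A (full_shift A)\<^esub> = \<one>\<^bsub>End S X\<^esub> \<and>
        inj_on \<phi> (carrier (End A (full_shift A)))"
proof (intro exI[of _ "\<lambda>f. restrict (act f) X"] conjI)
  show "(\<lambda>f. restrict (act f) X) \<in> hom (End A (full_shift A)) (End S X)"
  proof (rule homI)
    fix f g assume "f \<in> carrier (End A (full_shift A))" "g \<in> carrier (End A (full_shift A))"
    then have fg: "f \<in> cellular_automata A (full_shift A)" "g \<in> cellular_automata A (full_shift A)"
      by (auto simp: End_def)
    show "restrict (act (f \<otimes>\<^bsub>End A (full_shift A)\<^esub> g)) X =
        restrict (act f) X \<otimes>\<^bsub>End S X\<^esub> restrict (act g) X"
      using act_compose[OF fg] act_in[OF fg(2)] by (auto simp: End_def compose_def restrict_def fun_eq_iff)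
  qed (use act_automaton in \<open>auto simp: End_def\<close>)
  show "restrict (act \<one>\<^bsub>End A (full_shift A)\<^esub>) X = \<one>\<^bsub>End S X\<^esub>"
    using act_id by (auto simp: End_def restrict_def fun_eq_iff)
  show "inj_on (\<lambda>f. restrict (act f) X) (carrier (End A (full_shift A)))"
  proof (rule inj_onI)
    fix f g assume fg: "f \<in> carrier (End A (full_shift A))" "g \<in> carrier (End A (full_shift A))"
      and eq: "restrict (act f) X = restrict (act g) X"
    have "act f x = act g x" if "x \<in> X" for x using fun_cong[OF eq, of x] that by simp
    then show "f = g" using fg by (intro act_injective) (auto simp: End_def)
  qed
qed

end

section \<open>The code inside an uncountable sofic shift\<close>

lemma concat_in_idempotent_class:
  assumes "(p @ p, p) \<in> syntactic_rel S X" "ws \<noteq> []" "\<And>w. w \<in> set ws \<Longrightarrow> (w, p) \<in> syntactic_rel S X"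
  shows "(concat ws, p) \<in> syntactic_rel S X"
  using assms(2,3)
proof (induction ws rule: list_nonempty_induct)
  case (cons w ws)
  have "(w @ concat ws, p @ p) \<in> syntactic_rel S X"
    using cons by (intro syntactic_rel_append) auto
  then show ?case using assms(1) syntactic_rel_trans by fastforce
qed simp

lemma periodic_point_in_subshift:
  assumes X: "subshift S X" and W: "W \<in> lists S" "W \<noteq> []"
    and pow: "\<And>k. 0 < k \<Longrightarrow> concat (replicate k W) \<in> language X"
  shows "(\<lambda>j. W ! nat (j mod int (length W))) \<in> X" (is "?x \<in> X")
proof (rule subshift_limit[OF X])
  let ?l = "length W"
  have l: "0 < ?l" using W(2) by simp
  have "W ! nat (j mod int ?l) \<in> S" for j
  proof -
    have "nat (j mod int ?l) < ?l" using l by (simp add: nat_less_iff)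
    then show ?thesis using W(1) by (metis in_listsD nth_mem)
  qed
  then show "?x \<in> full_shift S" by (simp add: in_full_shift_iff)
  fix m :: int
  define M where "M = nat \<bar>m\<bar> + 1"
  have rep: "concat (replicate k W) = concat (map (\<lambda>_. W) [0..<k])" for k
    by (simp add: map_replicate_const)
  have len: "length (concat (replicate k W)) = k * ?l" for k by (induction k) auto
  have "concat (replicate (2 * M) W) \<in> language X" by (rule pow) (simp add: M_def)
  from language_obtain_at[OF X this, of "- int (M * ?l)"]
  obtain z where z: "z \<in> X"
    "segment z (- int (M * ?l)) (2 * M * ?l) = concat (replicate (2 * M) W)"
    unfolding len by blast
  have "?x j = z j" if j: "\<bar>j\<bar> \<le> m" for j
  proof -
    define t where "t = nat (j + int (M * ?l))"
    have "int M * 1 \<le> int M * int ?l"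
      using l by (intro mult_left_mono) (simp_all del: length_greater_0_conv)
    moreover have "\<bar>j\<bar> < int M" using j unfolding M_def by linarith
    ultimately have M: "\<bar>j\<bar> < int (M * ?l)" by simp
    then have t: "int t = j + int (M * ?l)" "t < 2 * M * ?l" by (auto simp: t_def nat_less_iff)
    have "z j = segment z (- int (M * ?l)) (2 * M * ?l) ! t" using t by simp
    also have "\<dots> = W ! (t mod ?l)"
      unfolding z(2) rep using t(2) by (intro concat_map_uniform) auto
    also have "t mod ?l = nat (j mod int ?l)"
    proof -
      have "int (t mod ?l) = j mod int ?l" by (simp add: zmod_int t(1))
      then show ?thesis by linarith
    qed
    finally show ?thesis by simp
  qed
  then show "\<exists>z\<in>X. agree m ?x z" using z(1) unfolding agree_def by blast
qed

theorem lemma7: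
  fixes S :: "'s set" and X :: "(int \<Rightarrow> 's) set" and A :: "'a set"
  assumes "finite S" and "sofic_shift S X" and "uncountable X" and "finite A"
  shows "\<exists>\<phi>. \<phi> \<in> hom (End A (full_shift A)) (End S X) \<and>
             \<phi> \<one>\<^bsub>End A (full_shift A)\<^esub> = \<one>\<^bsub>End S X\<^esub> \<and>
             inj_on \<phi> (carrier (End A (full_shift A)))"
proof -
  have X: "subshift S X" using assms(2) by (simp add: sofic_shift_def)
  obtain p q where pq: "p \<noteq> q" "length p = length q" "p \<in> language X"
    "(p, q) \<in> syntactic_rel S X" "(p @ p, p) \<in> syntactic_rel S X"
    using uncountable_sofic_words[OF assms(1-3)] .
  have pqS: "p \<in> lists S" "q \<in> lists S" using pq(4) syntactic_rel_lists by blast+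
  have qp: "(q, p) \<in> syntactic_rel S X" "(p, p) \<in> syntactic_rel S X"
    by (rule syntactic_rel_sym[OF pq(4)], rule syntactic_rel_refl[OF pqS(1)])
  have finD: "finite (A \<times> A)" using assms(4) by simp
  show ?thesis
  proof (rule nonoverlapping_code[OF pq(2,1) finD])
    fix lpad pre suf rpad mid code n
    assume code: "lpad @ pre = p" "suf @ rpad = q"
      "\<And>d. mid d \<noteq> []" "\<And>d. set (mid d) \<subseteq> {p, q}"
      "\<And>d. code d = pre @ concat (mid d) @ suf"
      "\<And>d. length (code d) = n" "0 < n" "inj_on code (A \<times> A)"
      "\<And>d d' k. \<lbrakk>d \<in> A \<times> A; d' \<in> A \<times> A; 0 < k; k < n\<rbrakk> \<Longrightarrow> \<exists>i<n - k. code d ! (k + i) \<noteq> code d' ! i"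
    \<comment> \<open>The code words share their two cut outer blocks, and the uncut blocks between them form a
      product in the class of \<open>p\<close>.\<close>
    have mid: "(concat (mid d), p) \<in> syntactic_rel S X" for d
      using code(4)[of d] qp by (intro concat_in_idempotent_class pq(5) code(3)) auto
    have "pre \<in> lists S" "suf \<in> lists S" using pqS code(1,2) by auto
    then have equiv: "(code d, code d') \<in> syntactic_rel S X" for d d'
      unfolding code(5)
      by (intro syntactic_rel_append syntactic_rel_refl
          syntactic_rel_trans[OF mid syntactic_rel_sym[OF mid]])
    \<comment> \<open>Restoring the omitted ends of a code word gives a product of \<open>p\<close> and \<open>q\<close>, whose powers all
      occur in \<open>X\<close>; neighbouring code words are separated by these ends.\<close>
    define N where "N = length lpad + n + length rpad"
    have periodic: "\<exists>x\<in>X. \<forall>k. segment x (k * int N) n = code d" for d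
    proof -
      define W where "W = lpad @ code d @ rpad"
      have lenW: "length W = N" by (simp add: W_def N_def code(6))
      have "W = concat (p # mid d @ [q])" by (simp add: W_def code(5) flip: code(1,2))
      also have "(\<dots>, p) \<in> syntactic_rel S X"
        using code(4)[of d] qp by (intro concat_in_idempotent_class pq(5)) auto
      finally have W: "(W, p) \<in> syntactic_rel S X" .
      have "concat (replicate k W) \<in> language X" if "0 < k" for k
      proof -
        have "(concat (replicate k W), p) \<in> syntactic_rel S X"
          using that W by (intro concat_in_idempotent_class pq(5)) (auto simp: set_replicate_conv_if)
        then show ?thesis using pq(3) syntactic_rel_language by blast
      qed
      moreover have "W \<in> lists S" using W syntactic_rel_lists by blast
      moreover have "W \<noteq> []" using lenW code(7) by (auto simp: N_def)
      ultimately have "(\<lambda>j. W ! nat (j mod int N)) \<in> X"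
        using periodic_point_in_subshift[OF X, of W] lenW by simp
      then have "(\<lambda>j. W ! nat ((j + int (length lpad)) mod int N)) \<in> X"
        by (rule subshift_translate[OF X])
      moreover have "segment (\<lambda>j. W ! nat ((j + int (length lpad)) mod int N)) (k * int N) n = code d" for k
      proof (rule nth_equalityI)
        fix i assume "i < length (segment (\<lambda>j. W ! nat ((j + int (length lpad)) mod int N)) (k * int N) n)"
        then have i: "i < n" by simp
        have "(k * int N + int i + int (length lpad)) mod int N = int (i + length lpad) mod int N"
          by (simp add: add.assoc)
        also have "\<dots> = int (i + length lpad)" using i by (intro mod_pos_pos_trivial) (auto simp: N_def)
        finally have "nat ((k * int N + int i + int (length lpad)) mod int N) = i + length lpad" by simp
        then show "segment (\<lambda>j. W ! nat ((j + int (length lpad)) mod int N)) (k * int N) n ! i = code d ! i"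
          using i by (simp add: W_def nth_append code(6))
      qed (simp add: code(6))
      ultimately show ?thesis by blast
    qed
    interpret belt_code S X A code n "int N"
      using X code(6-9) equiv periodic by unfold_locales (auto simp: N_def)
    show ?thesis by (rule End_embedding)
  qed
qed

end
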